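(* Let $$\begin{aligned}D_{(2,2)}={}&b_1\otimes b_1\otimes b_2\otimes b_2+b_1\otimes b_2\otimes b_1\otimes b_2+b_1\otimes b_2\otimes b_2\otimes b_1\\&+b_2\otimes b_1\otimes b_1\otimes b_2+b_2\otimes b_1\otimes b_2\otimes b_1+b_2\otimes b_2\otimes b_1\otimes b_1\in(\mathbb{C}^2)^{\otimes4}\end{aligned}$$ be the weight-$(2,2)$ Dicke tensor. Then $\mathrm{q}_{\mathrm M}(D_{(2,2)})=\mathrm{q}(D_{(2,2)})=1$, where $\mathrm{q}$ is the subexponent and $\mathrm{q}_{\mathrm M}$ the monomial subexponent in the standard basis.
   Context: $b_1,\dots,b_n$ is the standard basis of $\mathbb{C}^n$. Products of $k$-tensors are regarded as $k$-tensors (legs grouped position by position), and powers carry the product bases. Let $\mathrm{T}=\sum_{i=1}^2b_i^{\otimes k}\in(\mathbb{C}^2)^{\otimes k}$ (here $k=4$). Restriction: for $\phi\in U_1\otimes\cdots\otimes U_k$, $\psi\in V_1\otimes\cdots\otimes V_k$ (finite-dimensional complex spaces), $\phi\ge\psi$ if there are linear maps $A_i:U_i\to V_i$ with $\psi=(A_1\otimes\cdots\otimes A_k)\phi$. Monomial degeneration: with bases fixed, $\phi\unrhd_{\mathrm M}\psi$ if, after regarding both as elements of a common larger tensor product space by zero-padding (extending the bases), $\psi$ lies in the Zariski closure of the orbit of $\phi$ under the group of $k$-tuples of invertible monomial matrices (a monomial matrix has at most one nonzero entry in each row and each column). Subexponent: $\mathrm{q}(\phi)=\bigl(\lim_{n\to\infty}\frac1n\min\{m\in\mathbb{N}\mid\phi^{\otimes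 m}\ge\mathrm{T}^{\otimes n}\}\bigr)^{-1}$. Monomial subexponent: $\mathrm{q}_{\mathrm M}(\phi)=\bigl(\lim_{n\to\infty}\frac1n\min\{m\in\mathbb{N}\mid\phi^{\otimes m}\unrhd_{\mathrm M}\mathrm{T}^{\otimes n}\}\bigr)^{-1}$. The minimum of the empty set is $\infty$ and $\infty^{-1}=0$. *)

theory Defs
  imports "HOL-Analysis.Analysis"
begin

section \<open>Tensors with fixed bases\<close>

text \<open>
  A \<open>k\<close>-tensor in \<open>U\<^sub>1 \<otimes> \<dots> \<otimes> U\<^sub>k\<close> with a fixed basis of each complex space \<open>U\<^sub>l\<close>:
  \<open>legs\<close> is the list of the \<open>k\<close> basis label sets and \<open>coord\<close> gives the coordinate of the tensor
  at every list of \<open>k\<close> labels.  The spaces are finite-dimensional, so the label sets are meant to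
  be finite.  Only the coordinates at members of \<open>listset\<close> of the legs (the basis of the tensor
  product) have a meaning, and no definition below looks at any other.
\<close>

datatype 'i tensor = Tensor (legs: "'i set list") (coord: "'i list \<Rightarrow> complex")

definition basis_tensor :: "'i list \<Rightarrow> 'i list \<Rightarrow> complex" where
  "basis_tensor b x = (if x = b then 1 else 0)"

text \<open>The vectors \<open>b\<^sub>1, b\<^sub>2\<close> of the standard basis of \<open>\<complex>\<^sup>2\<close> carry the labels 1 and 2.\<close>

definition unit_tensor2 :: "nat \<Rightarrow> nat tensor" where
  "unit_tensor2 k =
     Tensor (replicate k {1, 2}) (\<lambda>x. \<Sum>i\<in>{1, 2}. basis_tensor (replicate k i) x)"

definition dicke_2_2 :: "nat tensor" where
  "dicke_2_2 = Tensor (replicate 4 {1, 2})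
     (\<lambda>x. basis_tensor [1, 1, 2, 2] x + basis_tensor [1, 2, 1, 2] x + basis_tensor [1, 2, 2, 1] x
        + basis_tensor [2, 1, 1, 2] x + basis_tensor [2, 1, 2, 1] x + basis_tensor [2, 2, 1, 1] x)"

text \<open>
  The \<open>m\<close>-th power as a \<open>k\<close>-tensor: leg \<open>l\<close> carries \<open>U\<^sub>l\<^sup>\<otimes>\<^sup>m\<close> with its product basis, which is
  labelled by the lists of \<open>m\<close> labels of \<open>U\<^sub>l\<close>.
\<close>

definition tensor_power :: "'i tensor \<Rightarrow> nat \<Rightarrow> 'i list tensor" where
  "tensor_power \<phi> m =
     Tensor (map (\<lambda>I. {xs \<in> lists I. length xs = m}) (legs \<phi>))
            (\<lambda>x. \<Prod>t<m. coord \<phi> (map (\<lambda>xs. xs ! t) x))"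

section \<open>Restriction\<close>

text \<open>
  Coordinates of \<open>(A\<^sub>0 \<otimes> \<dots> \<otimes> A\<^sub>k\<^sub>-\<^sub>1) c\<close>, where \<open>A l j i\<close> is the entry in row \<open>j\<close> and column \<open>i\<close>
  of the matrix acting on leg \<open>l\<close> and \<open>I\<close> are the legs of \<open>c\<close>.
\<close>

definition apply_legs ::
  "(nat \<Rightarrow> 'j \<Rightarrow> 'i \<Rightarrow> complex) \<Rightarrow> 'i set list \<Rightarrow> ('i list \<Rightarrow> complex) \<Rightarrow> 'j list \<Rightarrow> complex" where
  "apply_legs A I c y = (\<Sum>x\<in>listset I. (\<Prod>l<length I. A l (y ! l) (x ! l)) * c x)"

definition restricts_to :: "'i tensor \<Rightarrow> 'j tensor \<Rightarrow> bool" where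
  "restricts_to \<phi> \<psi> \<longleftrightarrow> length (legs \<phi>) = length (legs \<psi>) \<and>
     (\<exists>A. \<forall>y\<in>listset (legs \<psi>). coord \<psi> y = apply_legs A (legs \<phi>) (coord \<phi>) y)"

section \<open>Monomial degeneration\<close>

definition monomial_matrix_on :: "'i set \<Rightarrow> ('i \<Rightarrow> 'i \<Rightarrow> complex) \<Rightarrow> bool" where
  "monomial_matrix_on K A \<longleftrightarrow>
     (\<forall>i\<in>K. \<forall>j\<in>K. \<forall>j'\<in>K. A i j \<noteq> 0 \<and> A i j' \<noteq> 0 \<longrightarrow> j = j') \<and>
     (\<forall>j\<in>K. \<forall>i\<in>K. \<forall>i'\<in>K. A i j \<noteq> 0 \<and> A i' j \<noteq> 0 \<longrightarrow> i = i')"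

definition invertible_matrix_on :: "'i set \<Rightarrow> ('i \<Rightarrow> 'i \<Rightarrow> complex) \<Rightarrow> bool" where
  "invertible_matrix_on K A \<longleftrightarrow> (\<exists>B. \<forall>i\<in>K. \<forall>j\<in>K.
     (\<Sum>h\<in>K. A i h * B h j) = (if i = j then 1 else 0) \<and>
     (\<Sum>h\<in>K. B i h * A h j) = (if i = j then 1 else 0))"

text \<open>The vector space \<open>\<complex>\<^sup>X\<close>, its polynomial functions, and the Zariski closure of a subset.\<close>

definition coord_space :: "'x set \<Rightarrow> ('x \<Rightarrow> complex) set" where
  "coord_space X = {v. \<forall>x. x \<notin> X \<longrightarrow> v x = 0}"

inductive poly_fun_on :: "'x set \<Rightarrow> (('x \<Rightarrow> complex) \<Rightarrow> complex) \<Rightarrow> bool" for X where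
  const: "poly_fun_on X (\<lambda>v. a)"
| coordinate: "x \<in> X \<Longrightarrow> poly_fun_on X (\<lambda>v. v x)"
| add: "poly_fun_on X p \<Longrightarrow> poly_fun_on X q \<Longrightarrow> poly_fun_on X (\<lambda>v. p v + q v)"
| mult: "poly_fun_on X p \<Longrightarrow> poly_fun_on X q \<Longrightarrow> poly_fun_on X (\<lambda>v. p v * q v)"

definition zariski_closure :: "'x set \<Rightarrow> ('x \<Rightarrow> complex) set \<Rightarrow> ('x \<Rightarrow> complex) set" where
  "zariski_closure X S = {v \<in> coord_space X.
     \<forall>p. poly_fun_on X p \<longrightarrow> (\<forall>s\<in>S. p s = 0) \<longrightarrow> p v = 0}"

text \<open>
  Zero-padding along a list \<open>E\<close> of maps of basis labels, one for each leg (used for maps that are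
  injective on the legs, so that the sum has at most one summand).
\<close>

definition zero_pad :: "('i \<Rightarrow> 'j) list \<Rightarrow> 'i tensor \<Rightarrow> 'j list \<Rightarrow> complex" where
  "zero_pad E \<phi> y = (\<Sum>x\<in>{x \<in> listset (legs \<phi>). map2 (\<lambda>e i. e i) E x = y}. coord \<phi> x)"

definition extends_bases :: "'j set list \<Rightarrow> ('i \<Rightarrow> 'j) list \<Rightarrow> 'i tensor \<Rightarrow> bool" where
  "extends_bases K E \<phi> \<longleftrightarrow> length K = length (legs \<phi>) \<and> length E = length (legs \<phi>) \<and>
     (\<forall>l<length (legs \<phi>). inj_on (E ! l) (legs \<phi> ! l) \<and> (E ! l) ` (legs \<phi> ! l) \<subseteq> K ! l)"

definition monomial_orbit :: "'j set list \<Rightarrow> ('j list \<Rightarrow> complex) \<Rightarrow> ('j list \<Rightarrow> complex) set" where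
  "monomial_orbit K c = {v. \<exists>A.
     (\<forall>l<length K. monomial_matrix_on (K ! l) (A l) \<and> invertible_matrix_on (K ! l) (A l)) \<and>
     v = (\<lambda>y. if y \<in> listset K then apply_legs A K c y else 0)}"

text \<open>The common larger space is \<open>\<complex>\<^sup>N\<^sup>1 \<otimes> \<dots> \<otimes> \<complex>\<^sup>N\<^sup>k\<close>, where leg \<open>l\<close> has the labels \<open>{..<N\<^sub>l}\<close>.\<close>

definition monomially_degenerates_to :: "'i tensor \<Rightarrow> 'j tensor \<Rightarrow> bool" where
  "monomially_degenerates_to \<phi> \<psi> \<longleftrightarrow>
     (\<exists>(N :: nat list) (E :: ('i \<Rightarrow> nat) list) (F :: ('j \<Rightarrow> nat) list).
        let K = map lessThan N in
          extends_bases K E \<phi> \<and> extends_bases K F \<psi> \<and>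
          zero_pad F \<psi> \<in> zariski_closure (listset K) (monomial_orbit K (zero_pad E \<phi>)))"

section \<open>Subexponents\<close>

text \<open>In the type of extended reals the infimum of the empty set is \<open>\<infinity>\<close>, and \<open>inverse \<infinity> = 0\<close>.\<close>

definition subexponent :: "'i tensor \<Rightarrow> ereal" where
  "subexponent \<phi> = inverse (lim (\<lambda>n::nat.
     (INF m\<in>{m::nat. restricts_to (tensor_power \<phi> m)
                        (tensor_power (unit_tensor2 (length (legs \<phi>))) n)}. ereal (real m))
       / ereal (real n)))"

definition monomial_subexponent :: "'i tensor \<Rightarrow> ereal" where
  "monomial_subexponent \<phi> = inverse (lim (\<lambda>n::nat.
     (INF m\<in>{m::nat. monomially_degenerates_to (tensor_power \<phi> m)
                        (tensor_power (unit_tensor2 (length (legs \<phi>))) n)}. ereal (real m))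
       / ereal (real n)))"

end

theory Submission
  imports Defs "HOL-Real_Asymp.Real_Asymp"
begin

text \<open>
  Write \<open>D\<close> for the Dicke tensor and \<open>T\<close> for the diagonal tensor of size 2.  Each leg of \<open>D\<^sup>\<otimes>\<^sup>m\<close> has
  dimension \<open>2\<^sup>m\<close>, and \<open>T\<^sup>\<otimes>\<^sup>n\<close> is the diagonal tensor of size \<open>2\<^sup>n\<close>.  Neither restriction nor monomial
  degeneration creates a diagonal tensor larger than the dimension of a leg, so \<open>m \<ge> n\<close> is necessary
  for both.  Both subexponents are therefore at most 1, and the content of the theorem is that
  \<open>m = n + O(\<surd>n)\<close> suffices.

  For this it is enough to pick \<open>2\<^sup>n\<close> labels in each leg of \<open>D\<^sup>\<otimes>\<^sup>m\<close> such that the entries of \<open>D\<^sup>\<otimes>\<^sup>m\<close> at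
  these labels form a diagonal tensor.  A restriction deletes the other labels by coordinate
  projections, and the projections are limits of invertible diagonal matrices, so that the same choice
  is a monomial degeneration.  A nonzero entry of \<open>D\<^sup>\<otimes>\<^sup>m\<close> is a word of \<open>m\<close> columns, each of which is a
  rearrangement of \<open>1122\<close>; its \<open>l\<close>-th label is the word in row \<open>l\<close>.  What is needed is a large set \<open>S\<close> of
  such words that is induced: mixing the rows of members of \<open>S\<close> never gives a word of the same kind,
  unless all the members are equal.

  The set \<open>S\<close> comes from Strassen's hashing argument.  The rows \<open>x\<^sub>0, \<dots>, x\<^sub>3\<close> of a word \<open>x\<close> have a constant
  sum.  Take a matrix \<open>A\<close> modulo an odd number \<open>q\<close>, with \<open>d\<close> rows, and let \<open>Q = q\<^sup>d\<close>.  There are \<open>6\<^sup>m\<close>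
  words, at most \<open>4 \<cdot> 18\<^sup>m\<close> pairs of words with a common row and at most \<open>6 \<cdot> 10\<^sup>m\<close> pairs with two common
  rows.  For a random \<open>A\<close> the words of a pair have equal images under \<open>A\<close> in all rows with probability
  at most \<open>Q\<^sup>-\<^sup>1\<close> if they have two common rows and \<open>Q\<^sup>-\<^sup>2\<close> if they have only one.  If \<open>Q\<close> is a suitable constant
  times \<open>3\<^bsup>m/2\<^esup>\<close>, then for some \<open>A\<close> at most half of the words are in a pair that \<open>A\<close> does not separate:
  here \<open>18\<^sup>m / Q\<^sup>2\<close> is a small multiple of \<open>6\<^sup>m\<close>, and \<open>10\<^sup>m / Q\<close> is small compared with \<open>6\<^sup>m\<close> because
  \<open>10/6 < \<surd>3\<close> (\<open>exists_separating_matrix\<close>).  The other words are called good.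

  Then fix shifts \<open>c\<^sub>l\<close> and consider the good words with \<open>A x\<^sub>l + c\<^sub>l = b\<close> for \<open>l < 3\<close>, where \<open>b\<close> is a
  vector with entries below \<open>q/3\<close> and given Euclidean norm.  If rows of such words with the vectors
  \<open>b\<^sub>0, \<dots>, b\<^sub>3\<close> are mixed to a new word, the constant sum of the rows gives \<open>b\<^sub>0 + b\<^sub>1 + b\<^sub>2 = 3 b\<^sub>3\<close> modulo
  \<open>q\<close>, hence over the integers, and four points of a sphere satisfy this only if they coincide, as in
  Behrend's construction of sets without arithmetic progressions.  So the mixed word has
  the same images under \<open>A\<close> as the good words whose rows it uses, hence equals each of them.  By the
  pigeonhole principle some choice of the shifts and the norm leaves a fraction of about
  \<open>Q\<^sup>-\<^sup>2 3\<^sup>-\<^sup>d\<close> of the words, which is \<open>6\<^sup>m \<cdot> 3\<^sup>-\<^sup>m = 2\<^sup>m\<close> up to lower order.  With \<open>q = 3\<^sup>d\<close> and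
  \<open>m = 2 d\<^sup>2 - 4\<close> the loss is \<open>2\<^bsup>O(d)\<^esup> = 2\<^bsup>O(\<surd>m)\<^esup>\<close> (\<open>exists_large_induced_matching\<close>).
\<close>

section \<open>Nonzero entries of powers of the Dicke tensor\<close>

definition dicke_support :: "nat list set" where
  "dicke_support = {[1,1,2,2], [1,2,1,2], [1,2,2,1], [2,1,1,2], [2,1,2,1], [2,2,1,1]}"

text \<open>
  A word is stored by columns, so that being in the support of the power is a condition on each
  entry of the list.  The rows, which are the labels of the entry in the four legs, are read off
  by \<open>leg\<close>.
\<close>

definition dicke_columns :: "nat \<Rightarrow> nat list list set" where
  "dicke_columns m = {x. set x \<subseteq> dicke_support \<and> length x = m}"

definition leg :: "nat \<Rightarrow> 'i list list \<Rightarrow> 'i list" where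
  "leg l x = map (\<lambda>p. p ! l) x"

lemma finite_dicke_support [simp]: "finite dicke_support"
  by (simp add: dicke_support_def)

lemma finite_dicke_columns [simp]: "finite (dicke_columns m)"
  by (simp add: dicke_columns_def finite_lists_length_eq)

lemma card_dicke_columns: "card (dicke_columns m) = 6 ^ m"
proof -
  have "card dicke_support = 6" by (simp add: dicke_support_def)
  then show ?thesis by (simp add: dicke_columns_def card_lists_length_eq)
qed

lemma length_leg [simp]: "length (leg l x) = length x"
  by (simp add: leg_def)

lemma leg_nth: "t < length x \<Longrightarrow> leg l x ! t = x ! t ! l"
  by (simp add: leg_def)

lemma less_4_cases: "l < (4::nat) \<longleftrightarrow> l = 0 \<or> l = 1 \<or> l = 2 \<or> l = 3"
  by auto

lemma dicke_support_facts:
  assumes "p \<in> dicke_support"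
  shows "length p = 4" "p ! 0 + p ! 1 + p ! 2 + p ! 3 = 6"
    "l < 4 \<Longrightarrow> p ! l = 1 \<or> p ! l = 2"
  using assms by (auto simp: dicke_support_def less_4_cases)

lemma dicke_columns_nth: "x \<in> dicke_columns m \<Longrightarrow> t < m \<Longrightarrow> x ! t \<in> dicke_support"
  using nth_mem[of t x] by (auto simp: dicke_columns_def)

lemma dicke_columns_length: "x \<in> dicke_columns m \<Longrightarrow> length x = m"
  by (simp add: dicke_columns_def)

text \<open>
  Agreement in given rows is a condition on each column separately, so a pair of words is a word
  of pairs.
\<close>

lemma card_agreeing_column_pairs:
  "card {(x, y) \<in> dicke_columns m \<times> dicke_columns m. \<forall>l\<in>J. leg l x = leg l y}
   = card {(p, p') \<in> dicke_support \<times> dicke_support. \<forall>l\<in>J. p ! l = p' ! l} ^ m"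
proof -
  let ?P = "{(p, p') \<in> dicke_support \<times> dicke_support. \<forall>l\<in>J. p ! l = p' ! l}"
  let ?X = "{(x, y) \<in> dicke_columns m \<times> dicke_columns m. \<forall>l\<in>J. leg l x = leg l y}"
  have fin: "finite ?P"
    by (rule finite_subset[of _ "dicke_support \<times> dicke_support"]) auto
  have "bij_betw (\<lambda>(x, y). zip x y) ?X {z. set z \<subseteq> ?P \<and> length z = m}"
  proof (rule bij_betw_byWitness[where f' = "\<lambda>z. (map fst z, map snd z)"])
    show "\<forall>a\<in>?X. (\<lambda>z. (map fst z, map snd z)) ((\<lambda>(x, y). zip x y) a) = a"
      by (auto simp: dicke_columns_def)
    show "\<forall>a'\<in>{z. set z \<subseteq> ?P \<and> length z = m}.
            (\<lambda>(x, y). zip x y) (map fst a', map snd a') = a'"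
      by (auto simp: zip_map_fst_snd)
    show "(\<lambda>(x, y). zip x y) ` ?X \<subseteq> {z. set z \<subseteq> ?P \<and> length z = m}"
    proof (intro image_subsetI)
      fix w assume "w \<in> ?X"
      then obtain x y where w: "w = (x, y)"
        and xy: "x \<in> dicke_columns m" "y \<in> dicke_columns m"
        and agree: "\<forall>l\<in>J. leg l x = leg l y"
        by auto
      have "x ! t \<in> dicke_support \<and> y ! t \<in> dicke_support \<and> (\<forall>l\<in>J. x ! t ! l = y ! t ! l)"
        if "t < m" for t
      proof (intro conjI ballI)
        show "x ! t \<in> dicke_support" "y ! t \<in> dicke_support"
          using xy that by (simp_all add: dicke_columns_nth)
        show "x ! t ! l = y ! t ! l" if "l \<in> J" for l
          using agree that xy \<open>t < m\<close> leg_nth[of t x l] leg_nth[of t y l]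
          by (simp add: dicke_columns_def)
      qed
      moreover have "length x = m" "length y = m"
        using xy by (simp_all add: dicke_columns_def)
      ultimately show "(\<lambda>(x, y). zip x y) w \<in> {z. set z \<subseteq> ?P \<and> length z = m}"
        by (auto simp: w set_zip)
    qed
    show "(\<lambda>z. (map fst z, map snd z)) ` {z. set z \<subseteq> ?P \<and> length z = m} \<subseteq> ?X"
    proof (intro image_subsetI)
      fix z assume z: "z \<in> {z. set z \<subseteq> ?P \<and> length z = m}"
      then have "fst p \<in> dicke_support" "snd p \<in> dicke_support" "\<forall>l\<in>J. fst p ! l = snd p ! l"
        if "p \<in> set z" for p
        using that by fastforce+
      with z show "(map fst z, map snd z) \<in> ?X"
        by (auto simp: dicke_columns_def leg_def)
    qed
  qed
  then have "card ?X = card {z. set z \<subseteq> ?P \<and> length z = m}"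
    by (rule bij_betw_same_card)
  with fin show ?thesis by (simp add: card_lists_length_eq)
qed

text \<open>
  An enumeration of the support, by which the two numbers 18 and 10 below are computed.
\<close>

definition dicke_list :: "nat list list" where
  "dicke_list = [[1,1,2,2], [1,2,1,2], [1,2,2,1], [2,1,1,2], [2,1,2,1], [2,2,1,1]]"

lemma card_agreeing_support_pairs:
  "card {(p, p') \<in> dicke_support \<times> dicke_support. \<forall>i\<in>set J. p ! i = p' ! i}
   = length (filter (\<lambda>(p, p'). list_all (\<lambda>i. p ! i = p' ! i) J) (List.product dicke_list dicke_list))"
proof -
  let ?L = "filter (\<lambda>(p, p'). list_all (\<lambda>i. p ! i = p' ! i) J) (List.product dicke_list dicke_list)"
  have D: "dicke_support = set dicke_list" "distinct dicke_list"
    by (simp_all add: dicke_support_def dicke_list_def)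
  have "{(p, p') \<in> dicke_support \<times> dicke_support. \<forall>i\<in>set J. p ! i = p' ! i} = set ?L"
    unfolding D(1) by (auto simp: list_all_iff)
  also have "card (set ?L) = length ?L"
    by (intro distinct_card distinct_filter distinct_product D(2))
  finally show ?thesis .
qed

lemma card_agree_1:
  assumes "l < 4"
  shows "card {(p, p') \<in> dicke_support \<times> dicke_support. \<forall>i\<in>{l}. p ! i = p' ! i} = 18"
proof -
  have "list_all (\<lambda>l. length (filter (\<lambda>(p, p'). list_all (\<lambda>i. p ! i = p' ! i) [l])
          (List.product dicke_list dicke_list)) = 18) [0..<4]"
    by code_simp
  moreover have "l \<in> set [0..<4]" using assms by simp
  ultimately show ?thesis
    using card_agreeing_support_pairs[of "[l]"] unfolding list_all_iff by simp
qed

lemma card_agree_2: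
  assumes "l < l'" "l' < 4"
  shows "card {(p, p') \<in> dicke_support \<times> dicke_support. \<forall>i\<in>{l,l'}. p ! i = p' ! i} = 10"
proof -
  have "list_all (\<lambda>l'. list_all (\<lambda>l. length (filter (\<lambda>(p, p'). list_all (\<lambda>i. p ! i = p' ! i) [l, l'])
          (List.product dicke_list dicke_list)) = 10) [0..<l']) [0..<4]"
    by code_simp
  moreover have "l' \<in> set [0..<4]" "l \<in> set [0..<l']" using assms by simp_all
  ultimately show ?thesis
    using card_agreeing_support_pairs[of "[l, l']"] unfolding list_all_iff by simp
qed

section \<open>Solutions of linear congruences\<close>

definition row_vectors :: "nat \<Rightarrow> int \<Rightarrow> (nat \<Rightarrow> int) set" where
  "row_vectors m q = {..<m} \<rightarrow>\<^sub>E {0..<q}"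

lemma finite_row_vectors [simp]: "finite (row_vectors m q)"
  by (simp add: row_vectors_def finite_PiE)

lemma card_row_vectors: "card (row_vectors m q) = nat q ^ m"
  by (simp add: row_vectors_def card_PiE)

text \<open>
  Congruences that determine the entries in the positions \<open>J\<close> from the other entries cost a factor
  \<open>q\<close> for each of these positions.
\<close>

lemma card_rows_le_if_determined:
  assumes "J \<subseteq> {..<m}" "R \<subseteq> row_vectors m q"
    and det: "\<And>a a' j. a \<in> R \<Longrightarrow> a' \<in> R \<Longrightarrow> (\<And>t. t < m \<Longrightarrow> t \<notin> J \<Longrightarrow> a t = a' t) \<Longrightarrow>
               j \<in> J \<Longrightarrow> q dvd a j - a' j"
  shows "card R \<le> nat q ^ (m - card J)"
proof -
  let ?T = "{..<m} - J"
  have "card R \<le> card (?T \<rightarrow>\<^sub>E {0..<q})"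
  proof (rule card_inj_on_le)
    show "(\<lambda>a. restrict a ?T) ` R \<subseteq> ?T \<rightarrow>\<^sub>E {0..<q}"
    proof (intro image_subsetI restrict_PiE_iff[THEN iffD2] ballI)
      fix a t assume "a \<in> R" "t \<in> ?T"
      then show "a t \<in> {0..<q}"
        using assms(2) unfolding row_vectors_def by (blast dest: PiE_mem)
    qed
    show "finite (?T \<rightarrow>\<^sub>E {0..<q})" by (simp add: finite_PiE)
    show "inj_on (\<lambda>a. restrict a ?T) R"
    proof (rule inj_onI)
      fix a a' assume a: "a \<in> R" "a' \<in> R" and eq: "restrict a ?T = restrict a' ?T"
      have off: "a t = a' t" if "t < m" "t \<notin> J" for t
        using that fun_cong[OF eq, of t] by auto
      have mem: "a \<in> {..<m} \<rightarrow>\<^sub>E {0..<q}" "a' \<in> {..<m} \<rightarrow>\<^sub>E {0..<q}"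
        using a assms(2) by (auto simp: row_vectors_def)
      show "a = a'"
      proof (rule PiE_ext[OF mem])
        fix t assume "t \<in> {..<m}"
        show "a t = a' t"
        proof (cases "t \<in> J")
          case True
          have r: "a t \<in> {0..<q}" "a' t \<in> {0..<q}"
            using mem \<open>t \<in> {..<m}\<close> by blast+
          have "q dvd a t - a' t" by (rule det[OF a off True])
          then have "a t mod q = a' t mod q" by (simp add: mod_eq_dvd_iff)
          with r show ?thesis by simp
        qed (use off \<open>t \<in> {..<m}\<close> in auto)
      qed
    qed
  qed
  also have "\<dots> = nat q ^ (m - card J)"
    using assms(1) by (simp add: card_PiE card_Diff_subset finite_subset[OF assms(1)])
  finally show ?thesis .
qed

lemma card_rows_orthogonal_1:
  assumes "j < m" "coprime (u j) q"
  shows "card {a \<in> row_vectors m q. q dvd (\<Sum>t<m. a t * u t)} \<le> nat q ^ (m - 1)"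
proof -
  have "card {a \<in> row_vectors m q. q dvd (\<Sum>t<m. a t * u t)} \<le> nat q ^ (m - card {j})"
  proof (rule card_rows_le_if_determined)
    fix a a' i
    assume a: "a \<in> {a \<in> row_vectors m q. q dvd (\<Sum>t<m. a t * u t)}"
      and a': "a' \<in> {a \<in> row_vectors m q. q dvd (\<Sum>t<m. a t * u t)}"
      and off: "\<And>t. t < m \<Longrightarrow> t \<notin> {j} \<Longrightarrow> a t = a' t" and i: "i \<in> {j}"
    have "(\<Sum>t<m. a t * u t) - (\<Sum>t<m. a' t * u t) = (\<Sum>t<m. (a t - a' t) * u t)"
      by (simp add: sum_subtractf left_diff_distrib)
    also have "\<dots> = (\<Sum>t\<in>{j}. (a t - a' t) * u t)"
      by (rule sum.mono_neutral_right) (use assms off in auto)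
    finally have "q dvd (a j - a' j) * u j"
      using a a' by (metis (mono_tags, lifting) dvd_diff mem_Collect_eq sum.empty sum.insert finite.emptyI
          empty_iff add.right_neutral)
    with assms(2) have "q dvd a j - a' j"
      by (simp add: coprime_commute coprime_dvd_mult_left_iff)
    with i show "q dvd a i - a' i" by simp
  qed (use assms in auto)
  then show ?thesis by simp
qed

text \<open>
  A single \<open>2 \<times> 2\<close> minor that is a unit modulo \<open>q\<close> makes the two congruences independent, also for
  composite \<open>q\<close>.  The minors that occur below are \<open>\<plusminus>1\<close> and \<open>\<plusminus>2\<close>, which is why \<open>q\<close> will be odd.
\<close>

lemma card_rows_orthogonal_2:
  assumes "j < m" "k < m" "j \<noteq> k" "coprime (u j * w k - u k * w j) q"
  shows "card {a \<in> row_vectors m q. q dvd (\<Sum>t<m. a t * u t) \<and> q dvd (\<Sum>t<m. a t * w t)}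
           \<le> nat q ^ (m - 2)"
proof -
  let ?R = "{a \<in> row_vectors m q. q dvd (\<Sum>t<m. a t * u t) \<and> q dvd (\<Sum>t<m. a t * w t)}"
  have "card ?R \<le> nat q ^ (m - card {j, k})"
  proof (rule card_rows_le_if_determined)
    fix a a' i
    assume a: "a \<in> ?R" and a': "a' \<in> ?R"
      and off: "\<And>t. t < m \<Longrightarrow> t \<notin> {j, k} \<Longrightarrow> a t = a' t" and i: "i \<in> {j, k}"
    have *: "q dvd (a j - a' j) * v j + (a k - a' k) * v k"
      if "q dvd (\<Sum>t<m. a t * v t)" "q dvd (\<Sum>t<m. a' t * v t)" for v
    proof -
      have "(\<Sum>t<m. a t * v t) - (\<Sum>t<m. a' t * v t) = (\<Sum>t<m. (a t - a' t) * v t)"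
        by (simp add: sum_subtractf left_diff_distrib)
      also have "\<dots> = (\<Sum>t\<in>{j, k}. (a t - a' t) * v t)"
        by (rule sum.mono_neutral_right) (use assms off in auto)
      also have "\<dots> = (a j - a' j) * v j + (a k - a' k) * v k"
        using assms(3) by simp
      finally show ?thesis using that by (metis dvd_diff)
    qed
    have u: "q dvd (a j - a' j) * u j + (a k - a' k) * u k" (is "_ dvd ?U")
      and w: "q dvd (a j - a' j) * w j + (a k - a' k) * w k" (is "_ dvd ?W")
      using a a' by (auto intro: *)
    \<comment> \<open>Cramer's rule modulo \<open>q\<close>\<close>
    have "q dvd ?U * w k - ?W * u k" "q dvd ?W * u j - ?U * w j"
      using u w by (auto intro: dvd_diff dvd_mult2)
    moreover have "?U * w k - ?W * u k = (a j - a' j) * (u j * w k - u k * w j)"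
      "?W * u j - ?U * w j = (a k - a' k) * (u j * w k - u k * w j)"
      by (simp_all add: algebra_simps)
    ultimately have "q dvd a j - a' j" "q dvd a k - a' k"
      using assms(4) by (simp_all add: coprime_commute coprime_dvd_mult_left_iff)
    with i show "q dvd a i - a' i" by auto
  qed (use assms in auto)
  with assms(3) show ?thesis by (simp add: numeral_2_eq_2)
qed

definition matrices :: "nat \<Rightarrow> nat \<Rightarrow> int \<Rightarrow> (nat \<Rightarrow> nat \<Rightarrow> int) set" where
  "matrices d m q = {..<d} \<rightarrow>\<^sub>E row_vectors m q"

lemma finite_matrices [simp]: "finite (matrices d m q)"
  by (simp add: matrices_def finite_PiE)

lemma card_matrices: "card (matrices d m q) = (nat q ^ d) ^ m"
  by (simp add: matrices_def card_PiE card_row_vectors power_mult[symmetric] mult.commute)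

lemma card_matrices_rowwise:
  "card {A \<in> matrices d m q. \<forall>i<d. P (A i)} = card {a \<in> row_vectors m q. P a} ^ d"
proof -
  have "{A \<in> matrices d m q. \<forall>i<d. P (A i)} = {..<d} \<rightarrow>\<^sub>E {a \<in> row_vectors m q. P a}"
    by (intro set_eqI) (simp add: matrices_def PiE_iff, blast)
  then show ?thesis by (simp add: card_PiE)
qed

section \<open>Hashing the rows by a random matrix\<close>

definition dot :: "nat \<Rightarrow> (nat \<Rightarrow> int) \<Rightarrow> nat list \<Rightarrow> int" where
  "dot m a w = (\<Sum>t<m. a t * int (w ! t))"

definition confusable :: "nat \<Rightarrow> nat \<Rightarrow> int \<Rightarrow> (nat \<Rightarrow> nat \<Rightarrow> int) \<Rightarrow> nat list list \<Rightarrow> nat list list \<Rightarrow> bool" where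
  "confusable d m q A x y \<longleftrightarrow>
     (\<forall>l<4. \<forall>i<d. q dvd dot m (A i) (leg l x) - dot m (A i) (leg l y))"

definition leg_diff :: "nat list list \<Rightarrow> nat list list \<Rightarrow> nat \<Rightarrow> nat \<Rightarrow> int" where
  "leg_diff x y l t = int (x ! t ! l) - int (y ! t ! l)"

lemma dot_diff_legs:
  assumes "x \<in> dicke_columns m" "y \<in> dicke_columns m"
  shows "dot m a (leg l x) - dot m a (leg l y) = (\<Sum>t<m. a t * leg_diff x y l t)"
  using assms
  by (simp add: dot_def leg_diff_def leg_nth dicke_columns_length sum_subtractf right_diff_distrib)

lemma leg_diff_values:
  assumes "x \<in> dicke_columns m" "y \<in> dicke_columns m" "t < m" "l < 4"
  shows "leg_diff x y l t \<in> {-1, 0, 1}"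
  using dicke_support_facts(3)[OF dicke_columns_nth[OF assms(1,3)] assms(4)]
    dicke_support_facts(3)[OF dicke_columns_nth[OF assms(2,3)] assms(4)]
  by (auto simp: leg_diff_def)

lemma leg_diff_sum:
  assumes "x \<in> dicke_columns m" "y \<in> dicke_columns m" "t < m"
  shows "leg_diff x y 0 t + leg_diff x y 1 t + leg_diff x y 2 t + leg_diff x y 3 t = 0"
  using dicke_support_facts(2)[OF dicke_columns_nth[OF assms(1,3)]]
    dicke_support_facts(2)[OF dicke_columns_nth[OF assms(2,3)]]
  by (simp add: leg_diff_def)

lemma leg_eq_iff_leg_diff:
  assumes "x \<in> dicke_columns m" "y \<in> dicke_columns m"
  shows "leg l x = leg l y \<longleftrightarrow> (\<forall>t<m. leg_diff x y l t = 0)"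
  using assms by (auto simp: list_eq_iff_nth_eq leg_nth dicke_columns_length leg_diff_def)

lemma dicke_columns_eqI:
  assumes "x \<in> dicke_columns m" "y \<in> dicke_columns m" "\<And>l. l < 4 \<Longrightarrow> leg l x = leg l y"
  shows "x = y"
proof (rule nth_equalityI)
  show "length x = length y" using assms by (simp add: dicke_columns_length)
  fix t assume "t < length x"
  then have t: "t < m" using assms by (simp add: dicke_columns_length)
  show "x ! t = y ! t"
  proof (rule nth_equalityI)
    show "length (x ! t) = length (y ! t)"
      using dicke_support_facts(1) dicke_columns_nth assms t by metis
    fix l assume "l < length (x ! t)"
    then have "l < 4" using dicke_support_facts(1)[OF dicke_columns_nth[OF assms(1) t]] by simp
    then show "x ! t ! l = y ! t ! l"
      using assms t leg_nth[of t x l] leg_nth[of t y l] by (simp add: dicke_columns_length)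
  qed
qed

text \<open>
  Applied to the differences of the rows of two words with exactly one common row.  If all minors
  vanished, then \<open>w = \<lambda> u\<close> with \<open>\<lambda> \<in> {-1, 0, 1}\<close>.  The value 0 contradicts \<open>w \<noteq> 0\<close>, the value \<open>-1\<close>
  contradicts \<open>v \<noteq> 0\<close>, and the value 1 gives \<open>v = -2 u\<close>, which has an entry \<open>\<plusminus>2\<close>.
\<close>

lemma minor_of_sign_vectors:
  fixes u w v :: "nat \<Rightarrow> int"
  assumes vals: "\<And>t. t < m \<Longrightarrow> u t \<in> {-1, 0, 1}" "\<And>t. t < m \<Longrightarrow> w t \<in> {-1, 0, 1}"
      "\<And>t. t < m \<Longrightarrow> v t \<in> {-1, 0, 1}"
    and sum: "\<And>t. t < m \<Longrightarrow> u t + w t + v t = 0"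
    and nz: "\<exists>t<m. u t \<noteq> 0" "\<exists>t<m. w t \<noteq> 0" "\<exists>t<m. v t \<noteq> 0"
  shows "\<exists>j<m. \<exists>k<m. j \<noteq> k \<and> u j * w k - u k * w j \<in> {-2, -1, 1, 2}"
proof (rule ccontr)
  assume contra: "\<not> ?thesis"
  obtain j where j: "j < m" "u j \<noteq> 0" using nz by blast
  have minor: "u j * w k = u k * w j" if "k < m" for k
  proof (cases "k = j")
    case False
    have "u j * w k - u k * w j \<in> {-2, -1, 0, 1, 2}"
      using vals(1)[OF j(1)] vals(2)[OF j(1)] vals(1)[OF that] vals(2)[OF that] by auto
    moreover have "u j * w k - u k * w j \<notin> {-2, -1, 1, 2}"
      using contra j(1) that False by blast
    ultimately show ?thesis by auto
  qed simp
  consider "w j = 0" | "w j = - u j" | "w j = u j"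
    using vals(1)[OF j(1)] vals(2)[OF j(1)] j(2) by auto
  then show False
  proof cases
    case 1
    then have "w k = 0" if "k < m" for k using minor[OF that] j by simp
    then show False using nz by blast
  next
    case 2
    then have "w k = - u k" if "k < m" for k using minor[OF that] j
      by (metis minus_mult_commute mult.commute mult_cancel_left)
    then have "v k = 0" if "k < m" for k using sum[OF that] that by fastforce
    then show False using nz by blast
  next
    case 3
    then have "v j = -2 * u j" using sum[OF j(1)] by simp
    then show False using vals(3)[OF j(1)] vals(1)[OF j(1)] j(2) by auto
  qed
qed

text \<open>
  One row in which the words differ gives one congruence for each of the \<open>d\<close> rows of \<open>A\<close>, hence the
  probability \<open>q\<^sup>-\<^sup>d\<close>.
\<close>

lemma card_confusing_matrices_1:
  assumes x: "x \<in> dicke_columns m" and y: "y \<in> dicke_columns m" and "x \<noteq> y" and q: "odd q" "0 < q"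
  shows "card {A \<in> matrices d m q. confusable d m q A x y} \<le> (nat q ^ d) ^ (m - 1)"
proof -
  obtain l where l: "l < 4" "leg l x \<noteq> leg l y"
    using dicke_columns_eqI[OF x y] \<open>x \<noteq> y\<close> by blast
  then obtain j where j: "j < m" "leg_diff x y l j \<noteq> 0"
    using leg_eq_iff_leg_diff[OF x y] by blast
  then have "coprime (leg_diff x y l j) q"
    using leg_diff_values[OF x y j(1) l(1)] by auto
  note row = card_rows_orthogonal_1[of j m "leg_diff x y l" q, OF j(1) this]
  have "card {A \<in> matrices d m q. confusable d m q A x y}
      \<le> card {A \<in> matrices d m q. \<forall>i<d. q dvd (\<Sum>t<m. A i t * leg_diff x y l t)}"
    by (rule card_mono) (use l(1) in \<open>auto simp: confusable_def dot_diff_legs[OF x y]\<close>)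
  also have "\<dots> \<le> (nat q ^ (m - 1)) ^ d"
    unfolding card_matrices_rowwise[where P = "\<lambda>a. q dvd (\<Sum>t<m. a t * leg_diff x y l t)"]
    by (rule power_mono[OF row]) simp
  finally show ?thesis by (simp add: power_mult[symmetric] mult.commute)
qed

text \<open>
  Of the three rows in which the words differ, two give independent congruences by
  \<open>minor_of_sign_vectors\<close>; the third follows from them, because the rows have a constant sum.
\<close>

lemma card_confusing_matrices_2:
  assumes x: "x \<in> dicke_columns m" and y: "y \<in> dicke_columns m"
    and l: "l < 4" "leg l x = leg l y"
    and others: "\<And>l'. l' < 4 \<Longrightarrow> l' \<noteq> l \<Longrightarrow> leg l' x \<noteq> leg l' y"
    and q: "odd q" "0 < q"
  shows "card {A \<in> matrices d m q. confusable d m q A x y} \<le> (nat q ^ d) ^ (m - 2)"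
proof -
  obtain l1 l2 l3 :: nat where L: "{l1, l2, l3} = {..<4} - {l}" "distinct [l, l1, l2, l3]"
  proof -
    consider "l = 0" | "l = 1" | "l = 2" | "l = 3" using l(1) by linarith
    then show ?thesis
      by cases (rule that[of 1 2 3] that[of 0 2 3] that[of 0 1 3] that[of 0 1 2]; auto)+
  qed
  have ls: "l1 < 4" "l2 < 4" "l3 < 4" "l1 \<noteq> l" "l2 \<noteq> l" "l3 \<noteq> l" using L by auto
  let ?u = "leg_diff x y l1" and ?w = "leg_diff x y l2" and ?v = "leg_diff x y l3"
  have "\<exists>j<m. \<exists>k<m. j \<noteq> k \<and> ?u j * ?w k - ?u k * ?w j \<in> {-2, -1, 1, 2}"
  proof (rule minor_of_sign_vectors)
    fix t assume t: "t < m"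
    show "?u t \<in> {-1, 0, 1}" "?w t \<in> {-1, 0, 1}" "?v t \<in> {-1, 0, 1}"
      using leg_diff_values[OF x y t] ls by blast+
    have "leg_diff x y l t = 0" using l leg_eq_iff_leg_diff[OF x y] t by blast
    moreover have "(\<Sum>i\<in>{l, l1, l2, l3}. leg_diff x y i t) = (\<Sum>i<4. leg_diff x y i t)"
      using L l(1) by (intro sum.cong) auto
    ultimately show "?u t + ?w t + ?v t = 0"
      using L(2) leg_diff_sum[OF x y t] by (simp add: eval_nat_numeral add.assoc)
  qed (use others ls leg_eq_iff_leg_diff[OF x y] in blast)+
  then obtain j k where jk: "j < m" "k < m" "j \<noteq> k" "?u j * ?w k - ?u k * ?w j \<in> {-2, -1, 1, 2}"
    by blast
  have "coprime (?u j * ?w k - ?u k * ?w j) q"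
    using jk(4) q(1) by auto
  note row = card_rows_orthogonal_2[of j m k ?u ?w q, OF jk(1-3) this]
  let ?P = "\<lambda>a. q dvd (\<Sum>t<m. a t * ?u t) \<and> q dvd (\<Sum>t<m. a t * ?w t)"
  have "card {A \<in> matrices d m q. confusable d m q A x y}
      \<le> card {A \<in> matrices d m q. \<forall>i<d. ?P (A i)}"
    by (rule card_mono) (use ls in \<open>auto simp: confusable_def dot_diff_legs[OF x y]\<close>)
  also have "\<dots> \<le> (nat q ^ (m - 2)) ^ d"
    unfolding card_matrices_rowwise[where P = ?P] by (rule power_mono[OF row]) simp
  finally show ?thesis by (simp add: power_mult[symmetric] mult.commute)
qed

definition bad_columns :: "nat \<Rightarrow> nat \<Rightarrow> int \<Rightarrow> (nat \<Rightarrow> nat \<Rightarrow> int) \<Rightarrow> nat list list set" where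
  "bad_columns d m q A = {x \<in> dicke_columns m. \<exists>y\<in>dicke_columns m. y \<noteq> x \<and>
     (\<exists>l<4. leg l x = leg l y) \<and> confusable d m q A x y}"

text \<open>
  The first moment bound.  Pairs with two common rows are much rarer than pairs with a common row but
  have to be counted separately, since only one independent congruence remains for them.
\<close>

lemma sum_card_bad_columns:
  assumes q: "odd q" "0 < q"
  shows "(\<Sum>A\<in>matrices d m q. card (bad_columns d m q A))
     \<le> 6 * 10 ^ m * (nat q ^ d) ^ (m - 1) + 4 * 18 ^ m * (nat q ^ d) ^ (m - 2)"
proof -
  let ?M = "matrices d m q" and ?\<Omega> = "dicke_columns m"
  define agree where "agree J = {(x, y) \<in> ?\<Omega> \<times> ?\<Omega>. \<forall>l\<in>J. leg l x = leg l y}" for J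
  define two where "two = (\<Union>(l, l')\<in>{(0,1),(0,2),(0,3),(1,2),(1,3),(2,3)}. agree {l, l'})"
  define one where "one = (\<Union>l<4. agree {l})"
  have fin: "finite (agree J)" for J
    unfolding agree_def by (rule finite_subset[of _ "?\<Omega> \<times> ?\<Omega>"]) auto
  have fin': "finite one" "finite two" using fin by (auto simp: one_def two_def)
  have two_le: "card two \<le> 6 * 10 ^ m"
  proof -
    let ?I = "{(0,1),(0,2),(0,3),(1,2),(1,3),(2,3)} :: (nat \<times> nat) set"
    have "card two \<le> (\<Sum>i\<in>?I. card (case i of (l, l') \<Rightarrow> agree {l, l'}))"
      unfolding two_def by (rule card_UN_le) simp
    also have "\<dots> \<le> (\<Sum>i\<in>?I. 10 ^ m)"
    proof (rule sum_mono)
      fix i assume "i \<in> ?I"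
      then obtain l l' where "i = (l, l')" "l < l'" "l' < 4" by auto
      then show "card (case i of (l, l') \<Rightarrow> agree {l, l'}) \<le> 10 ^ m"
        by (simp only: agree_def card_agreeing_column_pairs card_agree_2 prod.case order.refl)
    qed
    finally show ?thesis by simp
  qed
  have one_le: "card one \<le> 4 * 18 ^ m"
  proof -
    have "card one \<le> (\<Sum>l<4. card (agree {l}))"
      unfolding one_def by (rule card_UN_le) simp
    also have "\<dots> \<le> (\<Sum>l<4::nat. 18 ^ m)"
      by (rule sum_mono) (simp only: agree_def card_agreeing_column_pairs card_agree_1 lessThan_iff order.refl)
    finally show ?thesis by simp
  qed
  define pairs where "pairs = {(x, y) \<in> one. x \<noteq> y}"
  have pairs: "finite pairs" using fin' by (auto simp: pairs_def intro: finite_subset)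
  define N where "N p = card {A \<in> ?M. confusable d m q A (fst p) (snd p)}" for p
  have "card (bad_columns d m q A) \<le> card {p \<in> pairs. confusable d m q A (fst p) (snd p)}" for A
  proof -
    have "bad_columns d m q A \<subseteq> fst ` {p \<in> pairs. confusable d m q A (fst p) (snd p)}"
      unfolding bad_columns_def pairs_def one_def agree_def by force
    then show ?thesis using pairs by (intro surj_card_le) auto
  qed
  then have "(\<Sum>A\<in>?M. card (bad_columns d m q A))
      \<le> (\<Sum>A\<in>?M. \<Sum>p | p \<in> pairs \<and> confusable d m q A (fst p) (snd p). 1)"
    by (intro sum_mono) simp
  also have "\<dots> = (\<Sum>p\<in>pairs. \<Sum>A | A \<in> ?M \<and> confusable d m q A (fst p) (snd p). 1)"
    by (rule sum.swap_restrict) (simp_all add: pairs)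
  also have "\<dots> = (\<Sum>p\<in>pairs. N p)" by (simp add: N_def)
  also have "\<dots> = (\<Sum>p\<in>pairs \<inter> two. N p) + (\<Sum>p\<in>pairs - two. N p)"
    using pairs by (metis sum.Int_Diff)
  also have "(\<Sum>p\<in>pairs \<inter> two. N p) \<le> 6 * 10 ^ m * (nat q ^ d) ^ (m - 1)"
  proof -
    have "(\<Sum>p\<in>pairs \<inter> two. N p) \<le> of_nat (card (pairs \<inter> two)) * (nat q ^ d) ^ (m - 1)"
      unfolding N_def using q
      by (intro sum_bounded_above card_confusing_matrices_1)
         (auto simp: pairs_def one_def agree_def)
    also have "card (pairs \<inter> two) \<le> 6 * 10 ^ m"
      using two_le fin' by (meson card_mono inf_le2 order_trans)
    finally show ?thesis by simp
  qed
  also have "(\<Sum>p\<in>pairs - two. N p) \<le> 4 * 18 ^ m * (nat q ^ d) ^ (m - 2)"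
  proof -
    have "(\<Sum>p\<in>pairs - two. N p) \<le> of_nat (card (pairs - two)) * (nat q ^ d) ^ (m - 2)"
    proof (rule sum_bounded_above)
      fix p assume p: "p \<in> pairs - two"
      then obtain x y l where xy: "p = (x, y)" "x \<in> ?\<Omega>" "y \<in> ?\<Omega>" "l < 4" "leg l x = leg l y"
        by (auto simp: pairs_def one_def agree_def)
      have "leg l' x \<noteq> leg l' y" if "l' < 4" "l' \<noteq> l" for l'
      proof
        assume "leg l' x = leg l' y"
        with xy have "p \<in> agree {min l l', max l l'}"
          by (auto simp: agree_def min_def max_def)
        moreover have "(min l l', max l l') \<in> {(0,1),(0,2),(0,3),(1,2),(1,3),(2,3)}"
        proof -
          have "i < j \<Longrightarrow> j < 4 \<Longrightarrow> (i, j) \<in> {(0,1),(0,2),(0,3),(1,2),(1,3),(2,3)}" for i j :: nat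
            by auto
          moreover have "min l l' < max l l'" "max l l' < 4" using that xy(4) by auto
          ultimately show ?thesis .
        qed
        ultimately have "p \<in> two" unfolding two_def by blast
        with p show False by simp
      qed
      then show "N p \<le> (nat q ^ d) ^ (m - 2)"
        using card_confusing_matrices_2[OF xy(2-5)] q by (simp add: N_def xy(1))
    qed
    also have "card (pairs - two) \<le> card one"
      using fin' by (intro card_mono) (auto simp: pairs_def)
    also note one_le
    finally show ?thesis by simp
  qed
  finally show ?thesis by simp
qed

lemma exists_separating_matrix:
  assumes q: "odd q" "0 < q" and m: "2 \<le> m"
    and large: "12 * 10 ^ m * nat q ^ d + 8 * 18 ^ m \<le> 6 ^ m * (nat q ^ d)\<^sup>2"
  shows "\<exists>A\<in>matrices d m q. 2 * card (bad_columns d m q A) \<le> 6 ^ m"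
proof (rule ccontr)
  assume "\<not> ?thesis"
  then have few: "6 ^ m < 2 * card (bad_columns d m q A)" if "A \<in> matrices d m q" for A
    using that by (meson not_le)
  define Q where "Q = nat q ^ d"
  have "0 < Q" using q by (simp add: Q_def)
  have ne: "matrices d m q \<noteq> {}"
    using card_matrices[of d m q] \<open>0 < Q\<close> by (auto simp: Q_def)
  have pw: "Q ^ m = Q\<^sup>2 * Q ^ (m - 2)" "Q ^ (m - 1) = Q * Q ^ (m - 2)"
    using m by (simp_all flip: power_add power_Suc add: Suc_diff_Suc numeral_2_eq_2)
  have "6 ^ m * Q ^ m = (\<Sum>A\<in>matrices d m q. 6 ^ m)"
    by (simp add: card_matrices Q_def)
  also have "\<dots> < (\<Sum>A\<in>matrices d m q. 2 * card (bad_columns d m q A))"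
    by (rule sum_strict_mono) (use few ne in auto)
  also have "\<dots> \<le> 2 * (6 * 10 ^ m * Q ^ (m - 1) + 4 * 18 ^ m * Q ^ (m - 2))"
    using sum_card_bad_columns[OF q, of d m] by (simp add: sum_distrib_left[symmetric] Q_def)
  also have "\<dots> = (12 * 10 ^ m * Q + 8 * 18 ^ m) * Q ^ (m - 2)"
    unfolding pw by (simp add: algebra_simps)
  also have "\<dots> \<le> 6 ^ m * Q\<^sup>2 * Q ^ (m - 2)"
    using large unfolding Q_def[symmetric] by (rule mult_right_mono) simp
  also have "\<dots> = 6 ^ m * Q ^ m" unfolding pw by simp
  finally show False by simp
qed

section \<open>Large induced matchings\<close>

text \<open>
  A word \<open>z\<close> whose row \<open>l\<close> is the row \<open>l\<close> of some \<open>f l \<in> S\<close>, for each \<open>l\<close>, is a nonzero entry of the power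
  at labels that belong to \<open>S\<close>.  The condition says that the only such entries are the members of \<open>S\<close>
  themselves.  It implies that two members of \<open>S\<close> with a common row are equal: let \<open>z\<close> be one
  member, and let \<open>f\<close> take the other one in the common row and \<open>z\<close> in the remaining rows.
\<close>

definition induced_matching :: "nat \<Rightarrow> nat list list set \<Rightarrow> bool" where
  "induced_matching m S \<longleftrightarrow> S \<subseteq> dicke_columns m \<and>
     (\<forall>f. \<forall>z\<in>dicke_columns m. (\<forall>l<4. f l \<in> S \<and> leg l z = leg l (f l)) \<longrightarrow> (\<forall>l<4. f l = z))"

lemma sum_dot_legs:
  assumes "x \<in> dicke_columns m"
  shows "dot m a (leg 0 x) + dot m a (leg 1 x) + dot m a (leg 2 x) + dot m a (leg 3 x)
    = 6 * (\<Sum>t<m. a t)"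
proof -
  have "dot m a (leg 0 x) + dot m a (leg 1 x) + dot m a (leg 2 x) + dot m a (leg 3 x)
      = (\<Sum>t<m. a t * int (x ! t ! 0 + x ! t ! 1 + x ! t ! 2 + x ! t ! 3))"
    using assms by (simp add: dot_def leg_nth dicke_columns_length sum.distrib distrib_left)
  also have "\<dots> = (\<Sum>t<m. a t * 6)"
    by (rule sum.cong) (simp_all only: dicke_support_facts(2)[OF dicke_columns_nth[OF assms]] lessThan_iff of_nat_numeral)
  finally show ?thesis by (simp add: sum_distrib_right[symmetric])
qed

text \<open>
  Strict convexity: under the assumptions the squared distances of \<open>b\<^sub>0, b\<^sub>1, b\<^sub>2\<close> from \<open>b\<^sub>3\<close> add up to
  \<open>3 r - 2 \<cdot> 3 r + 3 r = 0\<close>.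
\<close>

lemma average_on_sphere:
  fixes b :: "nat \<Rightarrow> nat \<Rightarrow> int"
  assumes avg: "\<And>i. i < d \<Longrightarrow> b 0 i + b 1 i + b 2 i = 3 * b 3 i"
    and norm: "\<And>l. l < 4 \<Longrightarrow> (\<Sum>i<d. (b l i)\<^sup>2) = r"
    and "l < 4" "i < d"
  shows "b l i = b 3 i"
proof -
  have "(\<Sum>i<d. (b 0 i - b 3 i)\<^sup>2 + (b 1 i - b 3 i)\<^sup>2 + (b 2 i - b 3 i)\<^sup>2)
      = (\<Sum>i<d. (b 0 i)\<^sup>2 + (b 1 i)\<^sup>2 + (b 2 i)\<^sup>2 - 3 * (b 3 i)\<^sup>2)"
  proof (rule sum.cong)
    fix i assume "i \<in> {..<d}"
    then have b0: "b 0 i = 3 * b 3 i - b 1 i - b 2 i" using avg[of i] by simp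
    show "(b 0 i - b 3 i)\<^sup>2 + (b 1 i - b 3 i)\<^sup>2 + (b 2 i - b 3 i)\<^sup>2
        = (b 0 i)\<^sup>2 + (b 1 i)\<^sup>2 + (b 2 i)\<^sup>2 - 3 * (b 3 i)\<^sup>2"
      unfolding b0 by (simp add: power2_eq_square algebra_simps)
  qed simp
  also have "\<dots> = 0"
    using norm[of 0] norm[of 1] norm[of 2] norm[of 3]
    by (simp add: sum.distrib sum_subtractf sum_distrib_left[symmetric])
  finally have "\<forall>i\<in>{..<d}. (b 0 i - b 3 i)\<^sup>2 + (b 1 i - b 3 i)\<^sup>2 + (b 2 i - b 3 i)\<^sup>2 = 0"
    by (subst (asm) sum_nonneg_eq_0_iff) simp_all
  then have "(b 0 i - b 3 i)\<^sup>2 + (b 1 i - b 3 i)\<^sup>2 + (b 2 i - b 3 i)\<^sup>2 = 0"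
    using assms(4) by simp
  then have "(b 0 i - b 3 i)\<^sup>2 = 0 \<and> (b 1 i - b 3 i)\<^sup>2 = 0 \<and> (b 2 i - b 3 i)\<^sup>2 = 0"
    by (smt (verit) zero_le_power2)
  with assms(3) show ?thesis unfolding less_4_cases by auto
qed

text \<open>
  Pairs of a good word \<open>x\<close> and a vector \<open>b\<close> with entries below \<open>D\<close> are sorted by the shifts
  \<open>c\<^sub>l = b - A x\<^sub>l\<close> for \<open>l < 3\<close> and by the squared norm of \<open>b\<close>.  The words in a largest class form the
  matching.  The bound \<open>3 D \<le> q\<close> turns the congruence \<open>b\<^sub>0 + b\<^sub>1 + b\<^sub>2 = 3 b\<^sub>3\<close> modulo \<open>q\<close> into an equation,
  and makes \<open>b\<close> determined by \<open>x\<close> within a class, so that a class has as many words as pairs.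
\<close>

lemma exists_induced_matching_of_hash:
  fixes q D :: int
  assumes q: "0 < q" "3 * D \<le> q" and D: "0 < D" and d: "0 < d"
  shows "\<exists>S. induced_matching m S \<and>
     card (dicke_columns m - bad_columns d m q A) * nat D ^ d
       \<le> card S * ((nat q ^ d) ^ 3 * (d * (nat D)\<^sup>2))"
proof -
  let ?G = "dicke_columns m - bad_columns d m q A"
  let ?B = "{..<d} \<rightarrow>\<^sub>E {0..<D}"
  let ?K = "({..<3::nat} \<rightarrow>\<^sub>E ({..<d} \<rightarrow>\<^sub>E {0..<q})) \<times> {0..<int d * D\<^sup>2}"
  define shift where "shift x b = (\<lambda>l\<in>{..<3}. \<lambda>i\<in>{..<d}. (b i - dot m (A i) (leg l x)) mod q)" for x b
  define key where "key = (\<lambda>(x, b). (shift x b, \<Sum>i<d. (b i)\<^sup>2))"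
  have "key \<in> ?G \<times> ?B \<rightarrow> ?K"
  proof (intro Pi_I, clarify)
    fix x b assume b: "b \<in> ?B"
    have "(\<Sum>i<d. (b i)\<^sup>2) < (\<Sum>i<d. D\<^sup>2)"
    proof (rule sum_strict_mono)
      fix i assume "i \<in> {..<d}"
      then have "b i \<in> {0..<D}" using b by blast
      then show "(b i)\<^sup>2 < D\<^sup>2" by (intro power_strict_mono) auto
    qed (use d in auto)
    then have "(\<Sum>i<d. (b i)\<^sup>2) \<in> {0..<int d * D\<^sup>2}" by (simp add: sum_nonneg)
    moreover have "shift x b \<in> {..<3::nat} \<rightarrow>\<^sub>E ({..<d} \<rightarrow>\<^sub>E {0..<q})"
      using q(1) unfolding shift_def by (intro restrict_PiE_iff[THEN iffD2] ballI) simp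
    ultimately show "key (x, b) \<in> ?K" by (simp add: key_def)
  qed
  moreover have "finite ?K" "?K \<noteq> {}"
    using q D d by (auto simp: finite_PiE PiE_eq_empty_iff)
  ultimately obtain k where k: "k \<in> ?K"
    and big: "card (?G \<times> ?B) \<le> card (key -` {k} \<inter> (?G \<times> ?B)) * card ?K"
    using pigeonhole_card[of key "?G \<times> ?B" ?K] by (auto simp: finite_PiE)
  define W where "W = key -` {k} \<inter> (?G \<times> ?B)"
  define c where "c = fst k"
  have W: "x \<in> ?G" "b \<in> ?B" "(\<Sum>i<d. (b i)\<^sup>2) = snd k"
    "\<And>l i. l < 3 \<Longrightarrow> i < d \<Longrightarrow> q dvd b i - dot m (A i) (leg l x) - c l i"
    if "(x, b) \<in> W" for x b
  proof -
    have key: "key (x, b) = k" using that by (simp add: W_def)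
    show "x \<in> ?G" "b \<in> ?B" using that unfolding W_def by blast+
    show "(\<Sum>i<d. (b i)\<^sup>2) = snd k" unfolding key[symmetric] by (simp add: key_def)
    fix l i assume "l < (3::nat)" "i < d"
    then have "c l i = (b i - dot m (A i) (leg l x)) mod q"
      unfolding c_def key[symmetric] by (simp add: key_def shift_def)
    then show "q dvd b i - dot m (A i) (leg l x) - c l i"
      by (simp add: mod_eq_dvd_iff[symmetric])
  qed
  have "inj_on fst W"
  proof (rule inj_onI, clarsimp)
    fix x b b' assume b: "(x, b) \<in> W" and b': "(x, b') \<in> W"
    show "b = b'"
    proof (rule PiE_ext[OF W(2)[OF b] W(2)[OF b']])
      fix i assume "i \<in> {..<d}"
      then have "q dvd (b i - dot m (A i) (leg 0 x) - c 0 i) - (b' i - dot m (A i) (leg 0 x) - c 0 i)"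
        by (intro dvd_diff W(4)[OF b] W(4)[OF b']) auto
      then have "b i mod q = b' i mod q" by (simp add: mod_eq_dvd_iff)
      moreover have "b i \<in> {0..<D}" "b' i \<in> {0..<D}"
        using W(2)[OF b] W(2)[OF b'] \<open>i \<in> {..<d}\<close> by blast+
      ultimately show "b i = b' i" using q D by simp
    qed
  qed
  then have card_W: "card (fst ` W) = card W" by (rule card_image)
  have "induced_matching m (fst ` W)"
    unfolding induced_matching_def
  proof (intro conjI allI ballI impI)
    show "fst ` W \<subseteq> dicke_columns m" using W(1) by auto
    fix f z l
    assume z: "z \<in> dicke_columns m"
      and f: "\<forall>l<4. f l \<in> fst ` W \<and> leg l z = leg l (f l)" and l: "l < (4::nat)"
    have "\<forall>l. \<exists>b. l < 4 \<longrightarrow> (f l, b) \<in> W" using f by force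
    then obtain b where fb: "\<And>l. l < 4 \<Longrightarrow> (f l, b l) \<in> W" by metis
    have f_col: "f l \<in> dicke_columns m" if "l < 4" for l
      using W(1)[OF fb[OF that]] by simp
    have z_legs: "q dvd b l i - dot m (A i) (leg l z) - c l i" if "l < 3" "i < d" for l i
      using W(4)[OF fb that] f that by simp
    \<comment> \<open>The words \<open>z\<close> and \<open>f 3\<close> share the last row, hence the sums of their first three rows agree.\<close>
    have avg: "b 0 i + b 1 i + b 2 i = 3 * b 3 i" if i: "i < d" for i
    proof -
      have f3: "q dvd b 3 i - dot m (A i) (leg l (f 3)) - c l i" if "l < 3" for l
        using W(4)[OF fb that i] by simp
      have "q dvd (b 0 i - dot m (A i) (leg 0 z) - c 0 i) + (b 1 i - dot m (A i) (leg 1 z) - c 1 i)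
          + (b 2 i - dot m (A i) (leg 2 z) - c 2 i)
          - ((b 3 i - dot m (A i) (leg 0 (f 3)) - c 0 i) + (b 3 i - dot m (A i) (leg 1 (f 3)) - c 1 i)
          + (b 3 i - dot m (A i) (leg 2 (f 3)) - c 2 i))"
        by (intro dvd_diff dvd_add z_legs f3 i) simp_all
      also have "\<dots> = b 0 i + b 1 i + b 2 i - 3 * b 3 i"
        using sum_dot_legs[OF z, of "A i"] sum_dot_legs[OF f_col[of 3], of "A i"] f by simp
      finally have dvd: "q dvd b 0 i + b 1 i + b 2 i - 3 * b 3 i" .
      have "b l i \<in> {0..<D}" if "l < 4" for l
        using W(2)[OF fb[OF that]] i by blast
      from this[of 0] this[of 1] this[of 2] this[of 3]
      have "\<bar>b 0 i + b 1 i + b 2 i - 3 * b 3 i\<bar> < q" using q by auto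
      with dvd show ?thesis by (metis dvd_imp_le_int eq_iff_diff_eq_0 not_le abs_of_pos q(1))
    qed
    have b3: "b l' i = b 3 i" if "l' < 4" "i < d" for l' i
      by (rule average_on_sphere[OF avg W(3)[OF fb] that])
    have b_eq: "b l' i = b l i" if "l' < 4" "i < d" for l' i
      by (simp only: b3[OF that] b3[OF l that(2)])
    \<comment> \<open>All vectors \<open>b l\<close> coincide, so \<open>A\<close> takes the same value on row \<open>l'\<close> of \<open>z\<close>, which is a row of
      \<open>f l'\<close>, and on row \<open>l'\<close> of \<open>f l\<close>; for the last row this follows from the constant sum.\<close>
    have conf: "q dvd dot m (A i) (leg l' (f l)) - dot m (A i) (leg l' z)" if "l' < 3" "i < d" for l' i
    proof -
      have "q dvd (b l' i - dot m (A i) (leg l' z) - c l' i) - (b l i - dot m (A i) (leg l' (f l)) - c l' i)"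
        by (intro dvd_diff z_legs that W(4)[OF fb[OF l]])
      then show ?thesis using b_eq[of l' i] that by simp
    qed
    have "confusable d m q A (f l) z"
      unfolding confusable_def
    proof (intro allI impI)
      fix l' i assume "l' < (4::nat)" and i: "i < d"
      then consider "l' < 3" | "l' = 3" by linarith
      then show "q dvd dot m (A i) (leg l' (f l)) - dot m (A i) (leg l' z)"
      proof cases
        case 2
        have "q dvd (dot m (A i) (leg 0 z) - dot m (A i) (leg 0 (f l)))
           + (dot m (A i) (leg 1 z) - dot m (A i) (leg 1 (f l)))
           + (dot m (A i) (leg 2 z) - dot m (A i) (leg 2 (f l)))"
          using conf[of 0 i] conf[of 1 i] conf[of 2 i] i by (intro dvd_add) (simp_all add: dvd_diff_commute)
        also have "\<dots> = dot m (A i) (leg 3 (f l)) - dot m (A i) (leg 3 z)"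
          using sum_dot_legs[OF z, of "A i"] sum_dot_legs[OF f_col[OF l], of "A i"] by simp
        finally show ?thesis using 2 by simp
      qed (use conf i in simp)
    qed
    moreover have "leg l (f l) = leg l z" using f l by simp
    ultimately have "z \<noteq> f l \<Longrightarrow> f l \<in> bad_columns d m q A"
      unfolding bad_columns_def using f_col[OF l] z l by blast
    with W(1)[OF fb[OF l]] show "f l = z" by blast
  qed
  moreover have "card ?G * nat D ^ d \<le> card (fst ` W) * ((nat q ^ d) ^ 3 * (d * (nat D)\<^sup>2))"
    using big D unfolding card_W W_def[symmetric]
    by (simp add: card_cartesian_product card_PiE nat_mult_distrib nat_power_eq)
  ultimately show ?thesis by blast
qed

text \<open>
  The hypothesis of \<open>exists_separating_matrix\<close> for words of length \<open>2 M\<close> and \<open>Q = 3\<^bsup>M+2\<^esup>\<close>.  It reduces to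
  \<open>108 \<cdot> 300\<^sup>M \<le> 73 \<cdot> 324\<^sup>M\<close>.
\<close>

lemma hash_is_large_enough:
  assumes "23 \<le> (M::nat)"
  shows "12 * 10 ^ (2 * M) * 3 ^ (M + 2) + 8 * 18 ^ (2 * M) \<le> 6 ^ (2 * M) * (3 ^ (M + 2) :: nat)\<^sup>2"
proof -
  obtain n where n: "M = 23 + n" using assms le_Suc_ex by blast
  have "108 * 300 ^ M = 108 * 300 ^ 23 * (300::nat) ^ n" by (simp add: n power_add)
  also have "\<dots> \<le> 73 * 324 ^ 23 * 324 ^ n"
    by (rule mult_mono) (simp_all add: power_mono)
  also have "\<dots> = 73 * 324 ^ M" by (simp add: n power_add)
  finally have *: "108 * 300 ^ M + 8 * 324 ^ M \<le> 81 * (324::nat) ^ M" by simp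
  have "12 * 10 ^ (2 * M) * 3 ^ (M + 2) = 108 * (300::nat) ^ M"
    by (simp add: power_mult power_mult_distrib[symmetric])
  moreover have "8 * 18 ^ (2 * M) = 8 * (324::nat) ^ M" by (simp add: power_mult)
  moreover have "6 ^ (2 * M) * (3 ^ (M + 2) :: nat)\<^sup>2 = 81 * 324 ^ M"
    by (simp add: power_mult power_mult_distrib power2_eq_square power_mult_distrib[symmetric])
  ultimately show ?thesis using * by simp
qed

text \<open>
  The choice \<open>q = 3\<^sup>d\<close>, \<open>D = 3\<^bsup>d-1\<^esup>\<close> and \<open>m = 2 d\<^sup>2 - 4\<close> makes \<open>Q\<^sup>2 = 3\<^bsup>m+4\<^esup>\<close>.  The matching then has at least
  \<open>2\<^sup>m / (18 d 27\<^sup>d)\<close> members, and \<open>18 \<le> 2\<^sup>5\<close>, \<open>d \<le> 2\<^sup>d\<close>, \<open>27 \<le> 2\<^sup>5\<close>.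
\<close>

lemma exists_large_induced_matching:
  assumes d: "5 \<le> d"
  shows "\<exists>S. induced_matching (2 * d\<^sup>2 - 4) S \<and> 2 ^ (2 * d\<^sup>2 - 6 * d - 9) \<le> card S"
proof -
  define M where "M = d\<^sup>2 - 2"
  have dd: "25 \<le> d\<^sup>2" using power_mono[OF d, of 2] by simp
  have M: "d\<^sup>2 = M + 2" "23 \<le> M" "2 * d\<^sup>2 - 4 = 2 * M" using dd by (simp_all add: M_def)
  let ?m = "2 * M"
  have q: "nat (3 ^ d) ^ d = 3 ^ (M + 2)"
    unfolding M(1)[symmetric] by (simp add: nat_power_eq power_mult[symmetric] power2_eq_square)
  have "\<exists>A\<in>matrices d ?m (3 ^ d). 2 * card (bad_columns d ?m (3 ^ d) A) \<le> 6 ^ ?m"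
    by (rule exists_separating_matrix) (use hash_is_large_enough[OF M(2)] M(2) in \<open>simp_all add: q\<close>)
  then obtain A where A: "2 * card (bad_columns d ?m (3 ^ d) A) \<le> 6 ^ ?m" by blast
  let ?G = "dicke_columns ?m - bad_columns d ?m (3 ^ d) A"
  have "bad_columns d ?m (3 ^ d) A \<subseteq> dicke_columns ?m" by (auto simp: bad_columns_def)
  then have "card ?G = 6 ^ ?m - card (bad_columns d ?m (3 ^ d) A)"
    by (simp add: card_Diff_subset finite_subset card_dicke_columns)
  with A have G: "6 ^ ?m \<le> 2 * card ?G" by linarith
  obtain e where e: "d = Suc e" using d by (cases d) auto
  have "(3::nat) ^ (2 * e) = 9 ^ e" by (simp add: power_mult)
  then have pows: "nat (3 ^ d) ^ d = 3 ^ (M + 2)" "nat (3 ^ e) ^ d = 3 ^ (e * d)" "(nat (3 ^ e))\<^sup>2 = 9 ^ e"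
    using q by (simp_all add: nat_power_eq power_mult[symmetric] mult.commute[of e 2])
  obtain S where S: "induced_matching ?m S"
    and "card ?G * nat (3 ^ e) ^ d \<le> card S * ((nat (3 ^ d) ^ d) ^ 3 * (d * (nat (3 ^ e))\<^sup>2))"
    using exists_induced_matching_of_hash[of "3 ^ d" "3 ^ e" d ?m A] by (auto simp: e)
  then have le: "card ?G * 3 ^ (e * d) \<le> card S * ((3 ^ (M + 2)) ^ 3 * (d * 9 ^ e))"
    by (simp only: pows)
  define P K :: nat where "P = 3 ^ (M + 2)" and "K = 9 ^ M"
  have P: "(3::nat) ^ (e * d) * 3 ^ d = P"
  proof -
    have "e * d + d = M + 2" using M(1) by (simp add: e power2_eq_square)
    then show ?thesis by (simp only: P_def power_add[symmetric])
  qed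
  have P3: "P ^ 3 = P * (81 * K)"
    by (simp add: P_def K_def power_add power3_eq_cube power_mult_distrib[symmetric])
  have six: "(6::nat) ^ ?m = 4 ^ M * K"
    by (simp add: K_def power_mult power_mult_distrib[symmetric])
  have Y: "(9::nat) ^ e * 3 ^ d * 9 = 27 ^ d"
    by (simp add: e power_mult_distrib[symmetric])
  have "(9 * P * K) * 4 ^ M = 6 ^ ?m * (3 ^ (e * d) * 3 ^ d * 9)"
    unfolding P six by (simp only: mult_ac)
  also have "\<dots> \<le> 2 * card ?G * (3 ^ (e * d) * 3 ^ d * 9)"
    by (rule mult_le_mono1[OF G])
  also have "\<dots> = card ?G * 3 ^ (e * d) * (2 * 3 ^ d * 9)" by (simp only: mult_ac)
  also have "\<dots> \<le> card S * (P ^ 3 * (d * 9 ^ e)) * (2 * 3 ^ d * 9)"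
    unfolding P_def by (rule mult_le_mono1[OF le])
  also have "\<dots> = 2 * card S * d * P ^ 3 * (9 ^ e * 3 ^ d * 9)" by (simp only: mult_ac)
  also have "\<dots> = (9 * P * K) * (18 * d * 27 ^ d * card S)"
    unfolding Y P3 by (simp add: mult_ac)
  finally have "(9 * P * K) * 4 ^ M \<le> (9 * P * K) * (18 * d * 27 ^ d * card S)" .
  moreover have "0 < 9 * P * K" by (simp add: P_def K_def)
  ultimately have "4 ^ M \<le> 18 * d * 27 ^ d * card S" by (simp only: mult_le_cancel1)
  also have "\<dots> \<le> 2 ^ 5 * 2 ^ d * (2 ^ 5) ^ d * card S"
    by (intro mult_mono power_mono) (simp_all add: less_imp_le)
  also have "(2::nat) ^ 5 * 2 ^ d * (2 ^ 5) ^ d = 2 ^ (6 * d + 5)"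
    by (simp only: power_mult[symmetric] power_add[symmetric]) simp
  also have "(4::nat) ^ M = 2 ^ (2 * M)" by (simp add: power_mult)
  finally have "(2::nat) ^ (2 * M) \<le> 2 ^ (6 * d + 5) * card S" .
  moreover have "2 * M = (6 * d + 5) + (2 * d\<^sup>2 - 6 * d - 9)"
  proof -
    have "6 * d + 9 \<le> 2 * d\<^sup>2"
      using mult_le_mono1[OF d, of d] d unfolding power2_eq_square by linarith
    with M show ?thesis by linarith
  qed
  ultimately have "(2::nat) ^ (6 * d + 5) * 2 ^ (2 * d\<^sup>2 - 6 * d - 9) \<le> 2 ^ (6 * d + 5) * card S"
    by (simp only: power_add)
  then have "2 ^ (2 * d\<^sup>2 - 6 * d - 9) \<le> card S" by simp
  with S show ?thesis unfolding M(3) by blast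
qed

section \<open>Subtensors are restrictions and monomial degenerations\<close>

lemma in_listset_iff: "x \<in> listset I \<longleftrightarrow> length x = length I \<and> (\<forall>l<length I. x ! l \<in> I ! l)"
proof (induction I arbitrary: x)
  case (Cons A I)
  show ?case by (cases x) (auto simp: set_Cons_def Cons.IH less_Suc_eq_0_disj)
qed auto

lemma finite_listset: "(\<And>A. A \<in> set I \<Longrightarrow> finite A) \<Longrightarrow> finite (listset I)"
proof (induction I)
  case (Cons A I)
  have "listset (A # I) = (\<lambda>(a, x). a # x) ` (A \<times> listset I)"
    by (auto simp: set_Cons_def)
  with Cons show ?case by simp
qed simp

text \<open>
  If the relevant row of each matrix has a single nonzero entry, in column \<open>s l\<close>, then only one summand
  remains.  This covers coordinate projections as well as diagonal matrices.
\<close>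

lemma apply_legs_unit_rows:
  assumes "finite (listset I)" "\<And>l. l < length I \<Longrightarrow> s l \<in> I ! l"
    and "\<And>l i. l < length I \<Longrightarrow> i \<in> I ! l \<Longrightarrow> i \<noteq> s l \<Longrightarrow> A l (y ! l) i = 0"
  shows "apply_legs A I c y = (\<Prod>l<length I. A l (y ! l) (s l)) * c (map s [0..<length I])"
proof -
  let ?s = "map s [0..<length I]"
  have s: "?s \<in> listset I" using assms(2) by (simp add: in_listset_iff)
  have "apply_legs A I c y = (\<Sum>x\<in>{?s}. (\<Prod>l<length I. A l (y ! l) (x ! l)) * c x)"
    unfolding apply_legs_def
  proof (rule sum.mono_neutral_right)
    show "\<forall>x\<in>listset I - {?s}. (\<Prod>l<length I. A l (y ! l) (x ! l)) * c x = 0"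
    proof
      fix x assume x: "x \<in> listset I - {?s}"
      then have len: "length x = length I" and "x \<noteq> ?s" by (auto simp: in_listset_iff)
      then obtain l where l: "l < length I" "x ! l \<noteq> s l"
        using nth_equalityI[of x ?s] by auto
      then have "A l (y ! l) (x ! l) = 0"
        using assms(3) x by (simp add: in_listset_iff)
      then have "(\<Prod>l<length I. A l (y ! l) (x ! l)) = 0"
        using l(1) by (auto simp: prod_zero_iff)
      then show "(\<Prod>l<length I. A l (y ! l) (x ! l)) * c x = 0" by simp
    qed
  qed (use assms s in auto)
  also have "\<dots> = (\<Prod>l<length I. A l (y ! l) (s l)) * c ?s" by simp
  finally show ?thesis .
qed

text \<open>
  The deletion of labels is a common special case of restriction and of monomial degeneration.
\<close>

definition subtensor_via :: "(nat \<Rightarrow> 'j \<Rightarrow> 'i) \<Rightarrow> 'i tensor \<Rightarrow> 'j tensor \<Rightarrow> bool" where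
  "subtensor_via g \<phi> \<psi> \<longleftrightarrow> length (legs \<phi>) = length (legs \<psi>) \<and>
     (\<forall>l<length (legs \<psi>). inj_on (g l) (legs \<psi> ! l) \<and> g l ` (legs \<psi> ! l) \<subseteq> legs \<phi> ! l) \<and>
     (\<forall>y\<in>listset (legs \<psi>). coord \<psi> y = coord \<phi> (map (\<lambda>l. g l (y ! l)) [0..<length (legs \<psi>)]))"

lemma restricts_to_subtensor:
  assumes fin: "\<And>U. U \<in> set (legs \<phi>) \<Longrightarrow> finite U" and sub: "subtensor_via g \<phi> \<psi>"
  shows "restricts_to \<phi> \<psi>"
  unfolding restricts_to_def
proof (intro conjI exI ballI)
  show len: "length (legs \<phi>) = length (legs \<psi>)" using sub by (simp add: subtensor_via_def)
  fix y assume y: "y \<in> listset (legs \<psi>)"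
  let ?A = "\<lambda>l j i. if i = g l j then 1 else 0 :: complex"
  have "apply_legs ?A (legs \<phi>) (coord \<phi>) y
      = (\<Prod>l<length (legs \<phi>). ?A l (y ! l) (g l (y ! l)))
        * coord \<phi> (map (\<lambda>l. g l (y ! l)) [0..<length (legs \<phi>)])"
    by (rule apply_legs_unit_rows)
       (use sub y fin in \<open>auto simp: subtensor_via_def in_listset_iff image_subset_iff intro!: finite_listset\<close>)
  then show "coord \<psi> y = apply_legs ?A (legs \<phi>) (coord \<phi>) y"
    using sub y len by (simp add: subtensor_via_def)
qed

lemma poly_fun_on_tendsto:
  assumes "poly_fun_on X p" "\<And>x. x \<in> X \<Longrightarrow> ((\<lambda>\<tau>. v \<tau> x) \<longlongrightarrow> w x) F"
  shows "((\<lambda>\<tau>. p (v \<tau>)) \<longlongrightarrow> p w) F"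
  using assms(1) by induction (use assms(2) in \<open>auto intro: tendsto_intros\<close>)

text \<open>
  Polynomial functions are continuous, so the Zariski closure contains limits in the usual topology.
\<close>

lemma limit_in_zariski_closure:
  assumes "F \<noteq> bot" "w \<in> coord_space X" "\<forall>\<^sub>F \<tau> in F. v \<tau> \<in> S"
    "\<And>x. x \<in> X \<Longrightarrow> ((\<lambda>\<tau>. v \<tau> x) \<longlongrightarrow> w x) F"
  shows "w \<in> zariski_closure X S"
  unfolding zariski_closure_def
proof (intro CollectI conjI allI impI assms(2))
  fix p assume p: "poly_fun_on X p" "\<forall>s\<in>S. p s = 0"
  have "((\<lambda>\<tau>. p (v \<tau>)) \<longlongrightarrow> p w) F"
    using p(1) assms(4) by (rule poly_fun_on_tendsto)
  moreover have "\<forall>\<^sub>F \<tau> in F. p (v \<tau>) = 0"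
    using assms(3) by eventually_elim (use p(2) in blast)
  then have "((\<lambda>\<tau>. p (v \<tau>)) \<longlongrightarrow> 0) F" by (rule tendsto_eventually)
  ultimately show "p w = 0" using assms(1) tendsto_unique by blast
qed

lemma map2_apply_eq_map:
  assumes "length E = k" "length x = k"
  shows "map2 (\<lambda>e i. e i) E x = map (\<lambda>l. (E ! l) (x ! l)) [0..<k]"
  using assms by (intro nth_equalityI) auto

lemma zero_pad_image:
  assumes E: "extends_bases K E \<phi>" and x: "x \<in> listset (legs \<phi>)"
  shows "zero_pad E \<phi> (map (\<lambda>l. (E ! l) (x ! l)) [0..<length (legs \<phi>)]) = coord \<phi> x"
proof -
  let ?k = "length (legs \<phi>)"
  have "{x' \<in> listset (legs \<phi>). map2 (\<lambda>e i. e i) E x' = map (\<lambda>l. (E ! l) (x ! l)) [0..<?k]} = {x}"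
  proof (intro equalityI subsetI)
    fix x' assume x': "x' \<in> {x' \<in> listset (legs \<phi>). map2 (\<lambda>e i. e i) E x' = map (\<lambda>l. (E ! l) (x ! l)) [0..<?k]}"
    then have "(E ! l) (x' ! l) = (E ! l) (x ! l)" if "l < ?k" for l
      using E that by (auto simp: map2_apply_eq_map[of E ?k] extends_bases_def in_listset_iff)
    then have "x' ! l = x ! l" if "l < ?k" for l
      using E x x' that inj_onD[of "E ! l" "legs \<phi> ! l" "x' ! l" "x ! l"]
      by (simp add: extends_bases_def in_listset_iff)
    then show "x' \<in> {x}"
      using x x' nth_equalityI[of x' x] by (simp add: in_listset_iff)
  qed (use E x in \<open>auto simp: map2_apply_eq_map[of E ?k] extends_bases_def in_listset_iff\<close>)
  then show ?thesis by (simp add: zero_pad_def)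
qed

lemma zero_pad_nonzero:
  assumes "extends_bases K E \<phi>" "zero_pad E \<phi> y \<noteq> 0"
  obtains x where "x \<in> listset (legs \<phi>)" "y = map (\<lambda>l. (E ! l) (x ! l)) [0..<length (legs \<phi>)]"
proof -
  have "{x \<in> listset (legs \<phi>). map2 (\<lambda>e i. e i) E x = y} \<noteq> {}"
    using assms(2) unfolding zero_pad_def by (metis sum.empty)
  then show ?thesis
    using that assms(1) map2_apply_eq_map[of E "length (legs \<phi>)"]
    by (auto simp: extends_bases_def in_listset_iff)
qed

definition diagonal_matrix :: "('i \<Rightarrow> complex) \<Rightarrow> 'i \<Rightarrow> 'i \<Rightarrow> complex" where
  "diagonal_matrix a i j = (if i = j then a i else 0)"

lemma diagonal_matrix_monomial_invertible:
  assumes "finite K" "\<And>i. i \<in> K \<Longrightarrow> a i \<noteq> 0"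
  shows "monomial_matrix_on K (diagonal_matrix a)" "invertible_matrix_on K (diagonal_matrix a)"
proof -
  show "monomial_matrix_on K (diagonal_matrix a)"
    by (auto simp: monomial_matrix_on_def diagonal_matrix_def split: if_splits)
  show "invertible_matrix_on K (diagonal_matrix a)"
    unfolding invertible_matrix_on_def
    by (rule exI[of _ "diagonal_matrix (\<lambda>i. inverse (a i))"])
       (use assms in \<open>auto simp: diagonal_matrix_def if_distrib[of "\<lambda>x. x * _"] if_distrib[of "\<lambda>x. _ * x"] cong: if_cong\<close>)
qed

text \<open>
  The diagonal matrices that are 1 at the labels of \<open>\<psi>\<close> and \<open>\<tau>\<close> elsewhere are invertible for \<open>\<tau> \<noteq> 0\<close>
  and converge for \<open>\<tau> \<rightarrow> 0\<close> to the projections that delete the other labels.  As \<open>\<psi>\<close> fits into the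
  legs of \<open>\<phi>\<close>, the common larger space is that of \<open>\<phi>\<close> itself.
\<close>

lemma monomially_degenerates_to_subtensor:
  fixes \<phi> :: "'i tensor" and \<psi> :: "'j tensor"
  assumes fin: "\<And>U. U \<in> set (legs \<phi>) \<Longrightarrow> finite U" and sub: "subtensor_via g \<phi> \<psi>"
  shows "monomially_degenerates_to \<phi> \<psi>"
proof -
  let ?k = "length (legs \<phi>)"
  have len: "length (legs \<psi>) = ?k" using sub by (simp add: subtensor_via_def)
  have "\<forall>l. \<exists>e. l < ?k \<longrightarrow> bij_betw e (legs \<phi> ! l) {..<card (legs \<phi> ! l)}"
    using ex_bij_betw_finite_nat fin by (metis nth_mem atLeast0LessThan)
  then obtain e where e: "\<And>l. l < ?k \<Longrightarrow> bij_betw (e l) (legs \<phi> ! l) {..<card (legs \<phi> ! l)}"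
    by metis
  define N where "N = map card (legs \<phi>)"
  define K where "K = map lessThan N"
  define E where "E = map e [0..<?k]"
  define F where "F = map (\<lambda>l. e l \<circ> g l) [0..<?k]"
  have lens: "length K = ?k" "length E = ?k" "length F = ?k"
    by (simp_all add: K_def N_def E_def F_def)
  have nths: "K ! l = {..<card (legs \<phi> ! l)}" "E ! l = e l" "F ! l = e l \<circ> g l" if "l < ?k" for l
    using that by (simp_all add: K_def N_def E_def F_def)
  have finK: "finite (listset K)"
    by (rule finite_listset) (auto simp: K_def)
  have E: "extends_bases K E \<phi>"
    using e by (auto simp: extends_bases_def lens nths bij_betw_def)
  have F: "extends_bases K F \<psi>"
    unfolding extends_bases_def len lens
  proof (intro conjI allI impI refl)
    fix l assume l: "l < ?k"
    have g: "inj_on (g l) (legs \<psi> ! l)" "g l ` (legs \<psi> ! l) \<subseteq> legs \<phi> ! l"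
      using sub l len by (auto simp: subtensor_via_def)
    show "inj_on (F ! l) (legs \<psi> ! l)"
      using g e[OF l] l by (auto simp: nths bij_betw_def intro!: comp_inj_on intro: inj_on_subset)
    show "(F ! l) ` (legs \<psi> ! l) \<subseteq> K ! l"
      using g e[OF l] l by (auto simp: nths bij_betw_def)
  qed
  let ?img = "\<lambda>l. (F ! l) ` (legs \<psi> ! l)"
  define a where "a \<tau> l i = (if i \<in> ?img l then 1 else \<tau> :: complex)" for \<tau> l i
  define v where "v \<tau> y = (if y \<in> listset K
     then apply_legs (\<lambda>l. diagonal_matrix (a \<tau> l)) K (zero_pad E \<phi>) y else 0)" for \<tau> y
  have "zero_pad F \<psi> \<in> zariski_closure (listset K) (monomial_orbit K (zero_pad E \<phi>))"
  proof (rule limit_in_zariski_closure[where F = "at 0" and v = v])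
    show "zero_pad F \<psi> \<in> coord_space (listset K)"
      unfolding coord_space_def
    proof (intro CollectI allI impI)
      fix y assume "y \<notin> listset K"
      show "zero_pad F \<psi> y = 0"
      proof (rule ccontr)
        assume "zero_pad F \<psi> y \<noteq> 0"
        then obtain w where "w \<in> listset (legs \<psi>)" "y = map (\<lambda>l. (F ! l) (w ! l)) [0..<length (legs \<psi>)]"
          using zero_pad_nonzero[OF F] by blast
        then have "y \<in> listset K"
          using F by (auto simp: in_listset_iff extends_bases_def)
        with \<open>y \<notin> listset K\<close> show False by simp
      qed
    qed
    show "\<forall>\<^sub>F \<tau> in at 0. v \<tau> \<in> monomial_orbit K (zero_pad E \<phi>)"
    proof (rule eventually_mono[OF eventually_neq_at_within[of 0]])
      fix \<tau> :: complex assume "\<tau> \<noteq> 0"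
      then show "v \<tau> \<in> monomial_orbit K (zero_pad E \<phi>)"
        unfolding monomial_orbit_def v_def
        by (intro CollectI exI[of _ "\<lambda>l. diagonal_matrix (a \<tau> l)"] conjI allI impI refl
              diagonal_matrix_monomial_invertible) (auto simp: lens nths a_def)
    qed
    fix y assume y: "y \<in> listset K"
    have v: "v \<tau> y = (\<Prod>l<?k. a \<tau> l (y ! l)) * zero_pad E \<phi> y" for \<tau>
    proof -
      have "apply_legs (\<lambda>l. diagonal_matrix (a \<tau> l)) K (zero_pad E \<phi>) y
          = (\<Prod>l<length K. diagonal_matrix (a \<tau> l) (y ! l) (y ! l))
            * zero_pad E \<phi> (map (\<lambda>l. y ! l) [0..<length K])"
        by (rule apply_legs_unit_rows) (use y finK in \<open>auto simp: in_listset_iff diagonal_matrix_def\<close>)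
      moreover have "map (\<lambda>l. y ! l) [0..<length K] = y"
        using y map_nth[of y] by (simp add: in_listset_iff)
      ultimately show ?thesis using y by (simp add: v_def diagonal_matrix_def lens)
    qed
    have "((\<lambda>\<tau>. a \<tau> l (y ! l)) \<longlongrightarrow> a 0 l (y ! l)) (at 0)" for l
      by (cases "y ! l \<in> ?img l") (simp_all add: a_def)
    then have "((\<lambda>\<tau>. v \<tau> y) \<longlongrightarrow> (\<Prod>l<?k. a 0 l (y ! l)) * zero_pad E \<phi> y) (at 0)"
      unfolding v by (intro tendsto_intros)
    also have "(\<Prod>l<?k. a 0 l (y ! l)) * zero_pad E \<phi> y = zero_pad F \<psi> y"
    proof (cases "\<forall>l<?k. y ! l \<in> ?img l")
      case True
      then have "\<forall>l. \<exists>i. l < ?k \<longrightarrow> i \<in> legs \<psi> ! l \<and> y ! l = (F ! l) i" by blast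
      then obtain s where s: "\<And>l. l < ?k \<Longrightarrow> s l \<in> legs \<psi> ! l \<and> y ! l = (F ! l) (s l)" by metis
      define w where "w = map s [0..<?k]"
      have w: "w \<in> listset (legs \<psi>)" using s by (simp add: w_def in_listset_iff len)
      let ?x = "map (\<lambda>l. g l (w ! l)) [0..<?k]"
      have x: "?x \<in> listset (legs \<phi>)"
        using sub s by (auto simp: subtensor_via_def in_listset_iff len w_def)
      have yF: "y = map (\<lambda>l. (F ! l) (w ! l)) [0..<length (legs \<psi>)]"
        using y s by (intro nth_equalityI) (auto simp: in_listset_iff lens len w_def)
      moreover have "\<dots> = map (\<lambda>l. (E ! l) (?x ! l)) [0..<?k]"
        using len by (simp add: nths)
      ultimately have "zero_pad E \<phi> y = coord \<phi> ?x"
        using zero_pad_image[OF E x] by simp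
      also have "\<dots> = coord \<psi> w"
        using sub w by (simp add: subtensor_via_def len)
      also have "\<dots> = zero_pad F \<psi> y"
        using zero_pad_image[OF F w] by (simp add: yF)
      finally show ?thesis using True by (simp add: a_def)
    next
      case False
      then have "(\<Prod>l<?k. a 0 l (y ! l)) = 0"
        by (auto simp: a_def prod_zero_iff)
      moreover have "zero_pad F \<psi> y = 0"
      proof (rule ccontr)
        assume "zero_pad F \<psi> y \<noteq> 0"
        then obtain w where "w \<in> listset (legs \<psi>)" "y = map (\<lambda>l. (F ! l) (w ! l)) [0..<length (legs \<psi>)]"
          using zero_pad_nonzero[OF F] by blast
        with False show False by (auto simp: in_listset_iff len)
      qed
      ultimately show ?thesis by simp
    qed
    finally show "((\<lambda>\<tau>. v \<tau> y) \<longlongrightarrow> zero_pad F \<psi> y) (at 0)" .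
  qed simp
  with E F show ?thesis
    unfolding monomially_degenerates_to_def Let_def K_def by blast
qed

section \<open>Diagonal tensors are bounded by the dimension of a leg\<close>

text \<open>
  Gaussian elimination: a vector with a nonzero coordinate \<open>x\<close> is used to clear this coordinate in the
  others.
\<close>

lemma exists_linear_dependence:
  fixes f :: "'i \<Rightarrow> 'x \<Rightarrow> complex"
  assumes "finite X" "finite J" "card X < card J"
  shows "\<exists>c. (\<exists>j\<in>J. c j \<noteq> 0) \<and> (\<forall>x\<in>X. (\<Sum>j\<in>J. c j * f j x) = 0)"
  using assms
proof (induction X arbitrary: J f rule: finite_induct)
  case empty
  then have "J \<noteq> {}" by auto
  then show ?case by (intro exI[of _ "\<lambda>_. 1"]) auto
next
  case (insert x X)
  show ?case
  proof (cases "\<forall>j\<in>J. f j x = 0")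
    case True
    have "card X < card J" using insert by simp
    then obtain c where "\<exists>j\<in>J. c j \<noteq> 0" "\<forall>y\<in>X. (\<Sum>j\<in>J. c j * f j y) = 0"
      using insert.IH[OF insert.prems(1), of f] by blast
    with True show ?thesis by (intro exI[of _ c]) auto
  next
    case False
    then obtain p where p: "p \<in> J" "f p x \<noteq> 0" by blast
    define J' where "J' = J - {p}"
    define h where "h j y = f j y - f j x / f p x * f p y" for j y
    have "finite J'" "card X < card J'" using insert p by (simp_all add: J'_def)
    then obtain c where c: "\<exists>j\<in>J'. c j \<noteq> 0" "\<forall>y\<in>X. (\<Sum>j\<in>J'. c j * h j y) = 0"
      using insert.IH[of J' h] by blast
    define b where "b j = (if j = p then - (\<Sum>j\<in>J'. c j * f j x) / f p x else c j)" for j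
    have b: "(\<Sum>j\<in>J. b j * f j y) = (\<Sum>j\<in>J'. c j * h j y)" for y
    proof -
      have "(\<Sum>j\<in>J. b j * f j y) = b p * f p y + (\<Sum>j\<in>J'. b j * f j y)"
        unfolding J'_def by (rule sum.remove) (use insert.prems p in auto)
      also have "(\<Sum>j\<in>J'. b j * f j y) = (\<Sum>j\<in>J'. c j * f j y)"
        by (rule sum.cong) (auto simp: J'_def b_def)
      finally show ?thesis
        by (simp add: b_def h_def right_diff_distrib sum_subtractf sum_divide_distrib
            sum_distrib_right sum_negf[symmetric] mult.assoc)
    qed
    have "(\<Sum>j\<in>J. b j * f j y) = 0" if "y \<in> insert x X" for y
    proof (cases "y = x")
      case True
      then show ?thesis unfolding b by (simp add: h_def p)
    next
      case False
      with that c(2) show ?thesis unfolding b by simp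
    qed
    moreover have "\<exists>j\<in>J. b j \<noteq> 0" using c(1) by (auto simp: J'_def b_def)
    ultimately show ?thesis by blast
  qed
qed

definition is_diagonal_tensor :: "'j set \<Rightarrow> nat \<Rightarrow> 'j tensor \<Rightarrow> bool" where
  "is_diagonal_tensor J k \<psi> \<longleftrightarrow> legs \<psi> = replicate k J \<and>
     (\<forall>y\<in>listset (legs \<psi>). coord \<psi> y = (if \<forall>l<k. y ! l = y ! 0 then 1 else 0))"

text \<open>
  With all legs but the first fixed to a label \<open>j\<close>, the diagonal tensor becomes the \<open>j\<close>-th unit vector.
  If the first leg of \<open>\<phi>\<close> had fewer than \<open>card J\<close> labels, a nontrivial combination \<open>c\<close> of the rows of
  the first matrix would vanish; applied to these unit vectors it gives \<open>c j = 0\<close> for all \<open>j\<close>.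
\<close>

lemma restricts_to_diagonal_imp_card_le:
  assumes diag: "is_diagonal_tensor J k \<psi>" and k: "2 \<le> k" and J: "finite J"
    and fin: "finite (legs \<phi> ! 0)" and r: "restricts_to \<phi> \<psi>"
  shows "card J \<le> card (legs \<phi> ! 0)"
proof (rule ccontr)
  assume "\<not> ?thesis"
  then have less: "card (legs \<phi> ! 0) < card J" by simp
  obtain A where A: "\<And>y. y \<in> listset (legs \<psi>) \<Longrightarrow> coord \<psi> y = apply_legs A (legs \<phi>) (coord \<phi>) y"
    using r unfolding restricts_to_def by blast
  have len: "length (legs \<phi>) = k" using r diag by (simp add: restricts_to_def is_diagonal_tensor_def)
  obtain c where c: "\<exists>j\<in>J. c j \<noteq> 0" "\<forall>x\<in>legs \<phi> ! 0. (\<Sum>j\<in>J. c j * A 0 j x) = 0"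
    using exists_linear_dependence[OF fin J less, of "A 0"] by auto
  then obtain j where j: "j \<in> J" "c j \<noteq> 0" by blast
  define y where "y i = i # replicate (k - 1) j" for i
  have y_nth: "y i ! 0 = i" "0 < l \<Longrightarrow> l < k \<Longrightarrow> y i ! l = j" for i l
    by (auto simp: y_def nth_Cons')
  have y: "y i \<in> listset (legs \<psi>)" if "i \<in> J" for i
    using that j k diag by (auto simp: is_diagonal_tensor_def in_listset_iff y_def nth_Cons')
  have "coord \<psi> (y i) = (if i = j then 1 else 0)" if i: "i \<in> J" for i
  proof -
    have "(\<forall>l<k. y i ! l = y i ! 0) \<longleftrightarrow> i = j"
    proof
      assume "\<forall>l<k. y i ! l = y i ! 0"
      moreover have "1 < k" using k by simp
      ultimately have "y i ! 1 = y i ! 0" by blast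
      then show "i = j" using y_nth[where i = i] k by simp
    next
      assume "i = j"
      then show "\<forall>l<k. y i ! l = y i ! 0" using y_nth[where i = i] by (metis gr0I)
    qed
    then show ?thesis using diag y[OF i] by (simp add: is_diagonal_tensor_def)
  qed
  then have "(\<Sum>i\<in>J. c i * coord \<psi> (y i)) = (\<Sum>i\<in>J. if i = j then c i else 0)"
    by (intro sum.cong) simp_all
  then have "c j = (\<Sum>i\<in>J. c i * coord \<psi> (y i))"
    using j J by simp
  also have "\<dots> = (\<Sum>i\<in>J. \<Sum>x\<in>listset (legs \<phi>). c i * A 0 i (x ! 0) *
      ((\<Prod>l\<in>{1..<k}. A l j (x ! l)) * coord \<phi> x))"
  proof (rule sum.cong)
    fix i assume i: "i \<in> J"
    have "(\<Prod>l<k. A l (y i ! l) (x ! l)) = A 0 i (x ! 0) * (\<Prod>l\<in>{1..<k}. A l j (x ! l))" for x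
    proof -
      have "(\<Prod>l<k. A l (y i ! l) (x ! l))
          = A 0 (y i ! 0) (x ! 0) * (\<Prod>l\<in>{1..<k}. A l (y i ! l) (x ! l))"
        using k by (simp add: lessThan_atLeast0 prod.atLeast_Suc_lessThan)
      also have "(\<Prod>l\<in>{1..<k}. A l (y i ! l) (x ! l)) = (\<Prod>l\<in>{1..<k}. A l j (x ! l))"
        by (rule prod.cong) (auto simp: y_nth)
      finally show ?thesis by (simp add: y_nth)
    qed
    then show "c i * coord \<psi> (y i) = (\<Sum>x\<in>listset (legs \<phi>). c i * A 0 i (x ! 0) *
      ((\<Prod>l\<in>{1..<k}. A l j (x ! l)) * coord \<phi> x))"
      using A[OF y[OF i]] by (simp add: apply_legs_def len sum_distrib_left mult.assoc)
  qed simp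
  also have "\<dots> = (\<Sum>x\<in>listset (legs \<phi>). (\<Sum>i\<in>J. c i * A 0 i (x ! 0)) *
      ((\<Prod>l\<in>{1..<k}. A l j (x ! l)) * coord \<phi> x))"
    by (subst sum.swap) (simp add: sum_distrib_right)
  also have "\<dots> = 0"
    by (rule sum.neutral) (use c(2) k len in \<open>auto simp: in_listset_iff\<close>)
  finally show False using j by simp
qed

lemma poly_fun_on_prod:
  assumes "finite J" "\<And>j. j \<in> J \<Longrightarrow> y j \<in> X"
  shows "poly_fun_on X (\<lambda>v. \<Prod>j\<in>J. v (y j))"
  using assms
proof (induction J)
  case empty
  show ?case using poly_fun_on.const[of X 1] by simp
next
  case (insert j J)
  then show ?case
    using poly_fun_on.mult[OF poly_fun_on.coordinate[of "y j" X], of "\<lambda>v. \<Prod>j\<in>J. v (y j)"] by simp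
qed

text \<open>
  A monomial matrix moves the labels of the first leg of \<open>\<phi>\<close> to at most as many labels.  If there are
  fewer than \<open>card J\<close> of them, then in every member of the orbit at least one of the diagonal entries
  at \<open>J\<close> vanishes.  The product of these entries is a polynomial which vanishes on the orbit but equals
  1 at the diagonal tensor.
\<close>

lemma monomially_degenerates_to_diagonal_imp_card_le:
  fixes \<phi> :: "'i tensor" and \<psi> :: "'j tensor"
  assumes diag: "is_diagonal_tensor J k \<psi>" and k: "0 < k" and J: "finite J"
    and fin: "finite (legs \<phi> ! 0)" and r: "monomially_degenerates_to \<phi> \<psi>"
  shows "card J \<le> card (legs \<phi> ! 0)"
proof (rule ccontr)
  assume "\<not> ?thesis"
  then have less: "card (legs \<phi> ! 0) < card J" by simp
  obtain N :: "nat list" and E :: "('i \<Rightarrow> nat) list" and F :: "('j \<Rightarrow> nat) list"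
    where EF: "extends_bases (map lessThan N) E \<phi>" "extends_bases (map lessThan N) F \<psi>"
    and closure: "zero_pad F \<psi> \<in> zariski_closure (listset (map lessThan N))
                    (monomial_orbit (map lessThan N) (zero_pad E \<phi>))"
    using r unfolding monomially_degenerates_to_def Let_def by blast
  define K :: "nat set list" where "K = map lessThan N"
  note EF = EF[folded K_def] and closure = closure[folded K_def]
  have lens: "length (legs \<psi>) = k" "length K = k" "length (legs \<phi>) = k"
    using diag EF by (auto simp: is_diagonal_tensor_def extends_bases_def)
  have J_legs: "legs \<psi> ! l = J" if "l < k" for l
    using diag that by (simp add: is_diagonal_tensor_def)
  define y where "y j = map (\<lambda>l. (F ! l) j) [0..<k]" for j
  have yK: "y j \<in> listset K" if "j \<in> J" for j
    using EF(2) that by (auto simp: in_listset_iff y_def lens extends_bases_def J_legs)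
  have y_coord: "zero_pad F \<psi> (y j) = 1" if j: "j \<in> J" for j
  proof -
    have x: "replicate k j \<in> listset (legs \<psi>)"
      using j by (simp add: in_listset_iff lens J_legs)
    have "y j = map (\<lambda>l. (F ! l) (replicate k j ! l)) [0..<length (legs \<psi>)]"
      by (simp add: y_def lens)
    then have "zero_pad F \<psi> (y j) = coord \<psi> (replicate k j)"
      using zero_pad_image[OF EF(2) x] by simp
    with x diag k show ?thesis by (simp add: is_diagonal_tensor_def)
  qed
  define p where "p v = (\<Prod>j\<in>J. v (y j))" for v :: "nat list \<Rightarrow> complex"
  have p: "poly_fun_on (listset K) p"
    unfolding p_def by (rule poly_fun_on_prod[OF J yK])
  have "p v = 0" if v: "v \<in> monomial_orbit K (zero_pad E \<phi>)" for v
  proof -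
    obtain A where A: "\<And>l. l < k \<Longrightarrow> monomial_matrix_on (K ! l) (A l)"
      and v: "v = (\<lambda>y. if y \<in> listset K then apply_legs A K (zero_pad E \<phi>) y else 0)"
      using v unfolding monomial_orbit_def lens by blast
    define Y where "Y = {i \<in> K ! 0. \<exists>h\<in>(E ! 0) ` (legs \<phi> ! 0). A 0 i h \<noteq> 0}"
    define col where "col h = (THE i. i \<in> K ! 0 \<and> A 0 i h \<noteq> 0)" for h
    have "Y \<subseteq> col ` (E ! 0) ` (legs \<phi> ! 0)"
    proof
      fix i assume "i \<in> Y"
      then obtain h where h: "i \<in> K ! 0" "h \<in> (E ! 0) ` (legs \<phi> ! 0)" "A 0 i h \<noteq> 0"
        by (auto simp: Y_def)
      then have "h \<in> K ! 0" using EF(1) k lens by (auto simp: extends_bases_def)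
      then have "col h = i"
        using A[OF k] h unfolding col_def monomial_matrix_on_def by blast
      with h show "i \<in> col ` (E ! 0) ` (legs \<phi> ! 0)" by blast
    qed
    have injF: "inj_on (F ! 0) J"
      using EF(2) k lens J_legs[of 0] by (auto simp: extends_bases_def)
    from \<open>Y \<subseteq> _\<close> have "card Y \<le> card (col ` (E ! 0) ` (legs \<phi> ! 0))"
      using fin by (intro card_mono) auto
    also have "\<dots> \<le> card (legs \<phi> ! 0)"
      by (metis card_image_le fin finite_imageI order_trans)
    also have "\<dots> < card J" by (rule less)
    also have "card J = card ((F ! 0) ` J)" by (rule card_image[OF injF, symmetric])
    finally have "\<not> (F ! 0) ` J \<subseteq> Y"
      using fin \<open>Y \<subseteq> _\<close> by (meson card_mono finite_imageI finite_subset not_le)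
    then obtain j where j: "j \<in> J" "(F ! 0) j \<notin> Y" by blast
    have "apply_legs A K (zero_pad E \<phi>) (y j) = 0"
      unfolding apply_legs_def
    proof (rule sum.neutral, rule ballI, rule ccontr)
      fix x assume x: "x \<in> listset K"
        and nz: "(\<Prod>l<length K. A l (y j ! l) (x ! l)) * zero_pad E \<phi> x \<noteq> 0"
      then have "A 0 (y j ! 0) (x ! 0) \<noteq> 0" using k by (auto simp: prod_zero_iff lens)
      moreover obtain w where "w \<in> listset (legs \<phi>)" "x = map (\<lambda>l. (E ! l) (w ! l)) [0..<length (legs \<phi>)]"
        using zero_pad_nonzero[OF EF(1)] nz by (metis mult_zero_right)
      then have "x ! 0 \<in> (E ! 0) ` (legs \<phi> ! 0)" using k lens by (auto simp: in_listset_iff)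
      moreover have "y j ! 0 \<in> K ! 0" using yK[OF j(1)] k lens by (simp add: in_listset_iff)
      ultimately have "y j ! 0 \<in> Y" by (auto simp: Y_def)
      with j(2) k show False by (simp add: y_def)
    qed
    then have "v (y j) = 0" by (simp add: v)
    then show "p v = 0" unfolding p_def using j(1) J by (auto simp: prod_zero_iff)
  qed
  with closure p have "p (zero_pad F \<psi>) = 0" unfolding zariski_closure_def by blast
  then show False by (simp add: p_def y_coord)
qed

section \<open>Powers of the two tensors\<close>

definition words :: "nat \<Rightarrow> nat list set" where
  "words n = {w \<in> lists {1, 2}. length w = n}"

lemma finite_words: "finite (words n)" and card_words: "card (words n) = 2 ^ n"
proof -
  have "words n = {w. set w \<subseteq> {1, 2} \<and> length w = n}"
    unfolding words_def lists_eq_set by blast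
  moreover have "card {1, 2::nat} = 2" by simp
  ultimately show "finite (words n)" "card (words n) = 2 ^ n"
    by (simp_all only: finite_lists_length_eq card_lists_length_eq finite.intros)
qed

lemma prod_of_indicators:
  "(\<Prod>t<(n::nat). if P t then 1 else 0) = (if \<forall>t<n. P t then 1 else (0::complex))"
  by (auto simp: prod_zero_iff)

lemma is_diagonal_tensor_unit_power:
  assumes "0 < k"
  shows "is_diagonal_tensor (words n) k (tensor_power (unit_tensor2 k) n)"
  unfolding is_diagonal_tensor_def
proof (intro conjI ballI)
  show legs: "legs (tensor_power (unit_tensor2 k) n) = replicate k (words n)"
    by (simp add: tensor_power_def unit_tensor2_def words_def)
  fix y assume "y \<in> listset (legs (tensor_power (unit_tensor2 k) n))"
  then have y: "length y = k" "\<And>l. l < k \<Longrightarrow> y ! l \<in> words n"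
    by (auto simp: legs in_listset_iff)
  have unit: "coord (unit_tensor2 k) (map (\<lambda>xs. xs ! t) y)
      = (if \<forall>l<k. y ! l ! t = y ! 0 ! t then 1 else 0)" if "t < n" for t
  proof -
    have "replicate k (1::nat) \<noteq> replicate k 2" using assms by (simp add: replicate_eq_replicate)
    then have "coord (unit_tensor2 k) (map (\<lambda>xs. xs ! t) y)
      = (if \<exists>i\<in>{1,2}. map (\<lambda>xs. xs ! t) y = replicate k i then 1 else 0)"
      by (auto simp: unit_tensor2_def basis_tensor_def)
    also have "(\<exists>i\<in>{1,2}. map (\<lambda>xs. xs ! t) y = replicate k i) \<longleftrightarrow> (\<forall>l<k. y ! l ! t = y ! 0 ! t)"
    proof
      assume "\<exists>i\<in>{1,2}. map (\<lambda>xs. xs ! t) y = replicate k i"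
      then obtain i where "map (\<lambda>xs. xs ! t) y = replicate k i" by blast
      then have "y ! l ! t = i" if "l < k" for l
        using that y(1) by (metis nth_map nth_replicate)
      then show "\<forall>l<k. y ! l ! t = y ! 0 ! t" using assms by simp
    next
      assume eq: "\<forall>l<k. y ! l ! t = y ! 0 ! t"
      have "y ! 0 \<in> lists {1, 2}" "length (y ! 0) = n" using y(2)[OF assms] by (auto simp: words_def)
      then have "y ! 0 ! t \<in> {1, 2}" using that nth_mem[of t "y ! 0"] by blast
      moreover have "map (\<lambda>xs. xs ! t) y = replicate k (y ! 0 ! t)"
      proof (rule nth_equalityI)
        fix l assume "l < length (map (\<lambda>xs. xs ! t) y)"
        then have l: "l < k" using y(1) by simp
        then have "y ! l ! t = y ! 0 ! t" using eq by blast
        with l y(1) show "map (\<lambda>xs. xs ! t) y ! l = replicate k (y ! 0 ! t) ! l" by simp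
      qed (simp add: y(1))
      ultimately show "\<exists>i\<in>{1,2}. map (\<lambda>xs. xs ! t) y = replicate k i" by blast
    qed
    finally show ?thesis .
  qed
  have "coord (tensor_power (unit_tensor2 k) n) y
      = (\<Prod>t<n. if \<forall>l<k. y ! l ! t = y ! 0 ! t then 1 else 0)"
    using unit by (simp add: tensor_power_def)
  also have "\<dots> = (if \<forall>t<n. \<forall>l<k. y ! l ! t = y ! 0 ! t then 1 else 0)"
    by (rule prod_of_indicators)
  also have "(\<forall>t<n. \<forall>l<k. y ! l ! t = y ! 0 ! t) \<longleftrightarrow> (\<forall>l<k. y ! l = y ! 0)"
  proof (intro iffI allI impI)
    fix l assume eq: "\<forall>t<n. \<forall>l<k. y ! l ! t = y ! 0 ! t" and l: "l < k"
    have len: "length (y ! l) = n" "length (y ! 0) = n"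
      using y(2)[OF l] y(2)[OF assms] by (simp_all add: words_def)
    show "y ! l = y ! 0"
    proof (rule nth_equalityI)
      fix t assume "t < length (y ! l)"
      with len(1) eq l show "y ! l ! t = y ! 0 ! t" by blast
    qed (simp add: len)
  next
    fix t l assume "\<forall>l<k. y ! l = y ! 0" and "l < k"
    then have "y ! l = y ! 0" by blast
    then show "y ! l ! t = y ! 0 ! t" by simp
  qed
  finally show "coord (tensor_power (unit_tensor2 k) n) y = (if \<forall>l<k. y ! l = y ! 0 then 1 else 0)" .
qed

lemma legs_dicke_power: "legs (tensor_power dicke_2_2 m) = replicate 4 (words m)"
  by (simp add: tensor_power_def dicke_2_2_def words_def)

lemma coord_dicke: "coord dicke_2_2 p = (if p \<in> dicke_support then 1 else 0)"
proof (cases "p \<in> dicke_support")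
  case True
  then show ?thesis unfolding dicke_support_def insert_iff empty_iff
    by (elim disjE) (simp_all add: dicke_2_2_def basis_tensor_def)
next
  case False
  then have n: "p \<noteq> [1,1,2,2]" "p \<noteq> [1,2,1,2]" "p \<noteq> [1,2,2,1]" "p \<noteq> [2,1,1,2]" "p \<noteq> [2,1,2,1]" "p \<noteq> [2,2,1,1]"
    unfolding dicke_support_def by blast+
  have "coord dicke_2_2 p = 0"
    unfolding dicke_2_2_def tensor.sel basis_tensor_def n[THEN if_not_P] by simp
  with False show ?thesis by (simp only: if_False)
qed

text \<open>
  A word is recovered from its four rows by transposition.
\<close>

lemma coord_dicke_power:
  assumes x: "x \<in> listset (legs (tensor_power dicke_2_2 m))"
  shows "coord (tensor_power dicke_2_2 m) x
    = (if \<exists>z\<in>dicke_columns m. \<forall>l<4. leg l z = x ! l then 1 else 0)"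
proof -
  have len: "length x = 4" "\<And>l. l < 4 \<Longrightarrow> length (x ! l) = m"
    using x by (auto simp: legs_dicke_power in_listset_iff words_def)
  have "coord (tensor_power dicke_2_2 m) x
      = (\<Prod>t<m. if map (\<lambda>xs. xs ! t) x \<in> dicke_support then 1 else 0)"
    by (simp add: tensor_power_def coord_dicke)
  also have "\<dots> = (if \<forall>t<m. map (\<lambda>xs. xs ! t) x \<in> dicke_support then 1 else 0)"
    by (rule prod_of_indicators)
  also have "(\<forall>t<m. map (\<lambda>xs. xs ! t) x \<in> dicke_support)
      \<longleftrightarrow> (\<exists>z\<in>dicke_columns m. \<forall>l<4. leg l z = x ! l)"
  proof
    assume supp: "\<forall>t<m. map (\<lambda>xs. xs ! t) x \<in> dicke_support"
    let ?z = "map (\<lambda>t. map (\<lambda>xs. xs ! t) x) [0..<m]"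
    have "?z \<in> dicke_columns m" using supp by (auto simp: dicke_columns_def)
    moreover have "leg l ?z = x ! l" if "l < 4" for l
      using that len by (intro nth_equalityI) (auto simp: leg_def)
    ultimately show "\<exists>z\<in>dicke_columns m. \<forall>l<4. leg l z = x ! l" by blast
  next
    assume "\<exists>z\<in>dicke_columns m. \<forall>l<4. leg l z = x ! l"
    then obtain z where z: "z \<in> dicke_columns m" "\<And>l. l < 4 \<Longrightarrow> leg l z = x ! l" by blast
    show "\<forall>t<m. map (\<lambda>xs. xs ! t) x \<in> dicke_support"
    proof (intro allI impI)
      fix t assume t: "t < m"
      note zt = dicke_columns_nth[OF z(1) t]
      have "map (\<lambda>xs. xs ! t) x = z ! t"
      proof (rule nth_equalityI)
        show "length (map (\<lambda>xs. xs ! t) x) = length (z ! t)"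
          using len dicke_support_facts(1)[OF zt] by simp
        fix l assume "l < length (map (\<lambda>xs. xs ! t) x)"
        then have "l < 4" using len by simp
        then show "map (\<lambda>xs. xs ! t) x ! l = z ! t ! l"
          using z(2)[of l] leg_nth[of t z l] t z(1) len by (simp add: dicke_columns_length)
      qed
      with zt show "map (\<lambda>xs. xs ! t) x \<in> dicke_support" by simp
    qed
  qed
  finally show ?thesis .
qed

lemma leg_in_words:
  assumes "z \<in> dicke_columns m" "l < 4"
  shows "leg l z \<in> words m"
proof -
  have "p ! l \<in> {1, 2}" if "p \<in> set z" for p
    using dicke_support_facts(3)[of p l] assms that by (auto simp: dicke_columns_def)
  then have "set (leg l z) \<subseteq> {1, 2}" unfolding leg_def set_map by (rule image_subsetI)
  moreover have "length (leg l z) = m" using assms(1) by (simp add: dicke_columns_length)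
  ultimately show ?thesis unfolding words_def lists_eq_set by blast
qed

text \<open>
  An injection \<open>f\<close> of the labels of \<open>T\<^sup>\<otimes>\<^sup>n\<close> into the matching relabels row by row.  The entry at the rows
  of \<open>f (y ! 0), \<dots>, f (y ! 3)\<close> is nonzero only if these words coincide, because the matching is
  induced.
\<close>

lemma subtensor_of_induced_matching:
  assumes S: "induced_matching m S" and large: "2 ^ n \<le> card S"
  shows "\<exists>g. subtensor_via g (tensor_power dicke_2_2 m) (tensor_power (unit_tensor2 4) n)"
proof -
  have "S \<subseteq> dicke_columns m" using S by (simp add: induced_matching_def)
  then have "finite S" by (rule finite_subset) simp
  then obtain f where f: "f ` words n \<subseteq> S" "inj_on f (words n)"
    using card_le_inj[of "words n" S] large by (auto simp: card_words finite_words)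
  have f_col: "f w \<in> dicke_columns m" if "w \<in> words n" for w
    using f \<open>S \<subseteq> _\<close> that by blast
  have induced: "h l = z" if "z \<in> dicke_columns m" "\<And>l. l < 4 \<Longrightarrow> h l \<in> S"
      "\<And>l. l < 4 \<Longrightarrow> leg l z = leg l (h l)" "l < 4" for h z l
    using S that unfolding induced_matching_def by blast
  define g where "g l w = leg l (f w)" for l w
  note diag = is_diagonal_tensor_unit_power[of 4 n]
  have legs: "legs (tensor_power (unit_tensor2 4) n) = replicate 4 (words n)"
    using diag by (simp add: is_diagonal_tensor_def)
  have "subtensor_via g (tensor_power dicke_2_2 m) (tensor_power (unit_tensor2 4) n)"
    unfolding subtensor_via_def legs legs_dicke_power length_replicate
  proof (intro conjI allI impI refl ballI)
    fix l assume l: "l < (4::nat)"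
    have "inj_on (g l) (words n)"
    proof (rule inj_onI)
      fix w w' assume w: "w \<in> words n" "w' \<in> words n" and eq: "g l w = g l w'"
      \<comment> \<open>The word \<open>f w'\<close> is a mixture of \<open>f w\<close>, in row \<open>l\<close>, and of itself in the other rows.\<close>
      have "(\<lambda>i. if i = l then f w else f w') l = f w'"
        by (rule induced) (use w f f_col eq l in \<open>auto simp: g_def\<close>)
      then show "w = w'" using f(2) w by (auto dest: inj_onD)
    qed
    then show "inj_on (g l) (replicate 4 (words n) ! l)" using l by simp
    show "g l ` (replicate 4 (words n) ! l) \<subseteq> replicate 4 (words m) ! l"
      using l f_col leg_in_words by (auto simp: g_def)
  next
    fix y assume "y \<in> listset (replicate 4 (words n))"
    then have y: "length y = 4" "\<And>l. l < 4 \<Longrightarrow> y ! l \<in> words n" and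
      y': "y \<in> listset (legs (tensor_power (unit_tensor2 4) n))"
      by (auto simp: in_listset_iff legs)
    let ?x = "map (\<lambda>l. g l (y ! l)) [0..<4]"
    have x: "?x \<in> listset (legs (tensor_power dicke_2_2 m))"
      using y f_col leg_in_words by (auto simp: legs_dicke_power in_listset_iff g_def)
    have "(\<exists>z\<in>dicke_columns m. \<forall>l<4. leg l z = ?x ! l) \<longleftrightarrow> (\<forall>l<4. y ! l = y ! 0)"
    proof
      assume "\<exists>z\<in>dicke_columns m. \<forall>l<4. leg l z = ?x ! l"
      then obtain z where z: "z \<in> dicke_columns m" "\<And>l. l < 4 \<Longrightarrow> leg l z = leg l (f (y ! l))"
        by (auto simp: g_def)
      have fz: "f (y ! l) = z" if "l < 4" for l
        using induced[of z "\<lambda>l. f (y ! l)" l] z y f that by blast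
      show "\<forall>l<4. y ! l = y ! 0"
        using fz y(2) inj_onD[OF f(2)] by (metis zero_less_numeral)
    next
      assume eq: "\<forall>l<4. y ! l = y ! 0"
      have "leg l (f (y ! 0)) = ?x ! l" if l: "l < 4" for l
      proof -
        have "y ! l = y ! 0" using eq l by blast
        then show ?thesis using l by (simp add: g_def)
      qed
      moreover have "f (y ! 0) \<in> dicke_columns m" using f_col y(2)[of 0] by simp
      ultimately show "\<exists>z\<in>dicke_columns m. \<forall>l<4. leg l z = ?x ! l" by blast
    qed
    then show "coord (tensor_power (unit_tensor2 4) n) y = coord (tensor_power dicke_2_2 m) ?x"
      using coord_dicke_power[OF x] diag y' by (simp add: is_diagonal_tensor_def)
  qed
  then show ?thesis by blast
qed

text \<open>
  Here \<open>d = k + 5\<close>, which satisfies \<open>d \<ge> 5\<close> and \<open>2 d\<^sup>2 - 6 d - 9 = 2 k\<^sup>2 + 14 k + 11 \<ge> n\<close>.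
\<close>

lemma unit_power_from_dicke_power:
  assumes "n \<le> 2 * k\<^sup>2"
  shows "restricts_to (tensor_power dicke_2_2 (2 * (k + 5)\<^sup>2 - 4)) (tensor_power (unit_tensor2 4) n)"
    and "monomially_degenerates_to (tensor_power dicke_2_2 (2 * (k + 5)\<^sup>2 - 4))
           (tensor_power (unit_tensor2 4) n)"
proof -
  let ?m = "2 * (k + 5)\<^sup>2 - 4"
  obtain S where S: "induced_matching ?m S" "2 ^ (2 * (k + 5)\<^sup>2 - 6 * (k + 5) - 9) \<le> card S"
    using exists_large_induced_matching[of "k + 5"] by auto
  have "n \<le> 2 * (k + 5)\<^sup>2 - 6 * (k + 5) - 9"
    using assms by (simp add: power2_eq_square algebra_simps)
  then have "(2::nat) ^ n \<le> 2 ^ (2 * (k + 5)\<^sup>2 - 6 * (k + 5) - 9)" by (intro power_increasing) auto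
  with S(2) have "2 ^ n \<le> card S" by linarith
  from subtensor_of_induced_matching[OF S(1) this] obtain g
    where g: "subtensor_via g (tensor_power dicke_2_2 ?m) (tensor_power (unit_tensor2 4) n)" by blast
  have fin: "finite U" if "U \<in> set (legs (tensor_power dicke_2_2 ?m))" for U
    using that by (simp add: legs_dicke_power finite_words)
  show "restricts_to (tensor_power dicke_2_2 ?m) (tensor_power (unit_tensor2 4) n)"
    by (rule restricts_to_subtensor[OF fin g])
  show "monomially_degenerates_to (tensor_power dicke_2_2 ?m) (tensor_power (unit_tensor2 4) n)"
    by (rule monomially_degenerates_to_subtensor[OF fin g])
qed

lemma dicke_power_lower_bound:
  assumes "restricts_to (tensor_power dicke_2_2 m) (tensor_power (unit_tensor2 4) n)
    \<or> monomially_degenerates_to (tensor_power dicke_2_2 m) (tensor_power (unit_tensor2 4) n)"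
  shows "n \<le> m"
proof -
  have "finite (legs (tensor_power dicke_2_2 m) ! 0)"
    by (simp add: legs_dicke_power finite_words)
  then have "card (words n) \<le> card (legs (tensor_power dicke_2_2 m) ! 0)"
    using assms restricts_to_diagonal_imp_card_le[OF is_diagonal_tensor_unit_power[of 4 n]]
      monomially_degenerates_to_diagonal_imp_card_le[OF is_diagonal_tensor_unit_power[of 4 n]]
      finite_words by auto
  then show ?thesis by (simp add: legs_dicke_power card_words)
qed

section \<open>The subexponents\<close>

text \<open>
  Both subexponents have this form.  With the least \<open>k\<close> such that \<open>n \<le> 2 k\<^sup>2\<close>, the minimum lies between
  \<open>n\<close> and \<open>2 (k + 5)\<^sup>2 \<le> 2 (\<surd>(n/2) + 6)\<^sup>2\<close>.
\<close>

lemma inverse_lim_least_ratio_eq_1: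
  fixes P :: "nat \<Rightarrow> nat \<Rightarrow> bool"
  assumes lower: "\<And>m n. P m n \<Longrightarrow> n \<le> m"
    and upper: "\<And>n k. n \<le> 2 * k\<^sup>2 \<Longrightarrow> P (2 * (k + 5)\<^sup>2 - 4) n"
  shows "inverse (lim (\<lambda>n. (INF m\<in>{m. P m n}. ereal (real m)) / ereal (real n))) = 1"
proof -
  let ?I = "\<lambda>n. INF m\<in>{m. P m n}. ereal (real m)"
  define u where "u n = 2 * (sqrt (real n / 2) + 6)\<^sup>2 / real n" for n
  have "(\<lambda>n. ?I n / ereal (real n)) \<longlonglongrightarrow> ereal 1"
  proof (rule tendsto_sandwich)
    show "\<forall>\<^sub>F n in sequentially. ereal 1 \<le> ?I n / ereal (real n)"
      using eventually_gt_at_top[of 0]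
    proof eventually_elim
      fix n :: nat assume n: "0 < n"
      have "ereal (real n) \<le> ?I n"
        by (rule INF_greatest) (use lower in auto)
      then show "ereal 1 \<le> ?I n / ereal (real n)"
        using n by (subst ereal_le_divide_pos) auto
    qed
    show "\<forall>\<^sub>F n in sequentially. ?I n / ereal (real n) \<le> ereal (u n)"
      using eventually_gt_at_top[of 0]
    proof eventually_elim
      fix n :: nat assume n: "0 < n"
      define k where "k = nat \<lceil>sqrt (real n / 2)\<rceil>"
      have k: "sqrt (real n / 2) \<le> real k" "real k \<le> sqrt (real n / 2) + 1"
        unfolding k_def by (auto simp: of_nat_nat)
      have "real n / 2 \<le> (real k)\<^sup>2"
        using power_mono[OF k(1), of 2] by simp
      then have "real n \<le> real (2 * k\<^sup>2)" by simp
      then have "n \<le> 2 * k\<^sup>2" by linarith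
      then have "?I n \<le> ereal (real (2 * (k + 5)\<^sup>2 - 4))"
        by (intro INF_lower) (simp add: upper)
      also have "real (2 * (k + 5)\<^sup>2 - 4) \<le> 2 * (real k + 5)\<^sup>2"
        by (simp add: of_nat_diff_if)
      also have "\<dots> \<le> 2 * (sqrt (real n / 2) + 6)\<^sup>2"
        using k by (intro mult_left_mono power_mono) auto
      finally have "?I n \<le> ereal (real n) * ereal (u n)"
        using n by (simp add: u_def)
      then show "?I n / ereal (real n) \<le> ereal (u n)"
        using n by (subst ereal_divide_le_pos) auto
    qed
    have "u \<longlonglongrightarrow> 1" unfolding u_def by real_asymp (simp add: powr_half_sqrt)
    then show "(\<lambda>n. ereal (u n)) \<longlonglongrightarrow> ereal 1" by simp
  qed simp
  then have "lim (\<lambda>n. ?I n / ereal (real n)) = ereal 1" by (rule limI)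
  then show ?thesis by simp
qed

theorem corollary1p2p5:
  shows "monomial_subexponent dicke_2_2 = subexponent dicke_2_2 \<and> subexponent dicke_2_2 = 1"
proof -
  have k: "length (legs dicke_2_2) = 4" by (simp add: dicke_2_2_def)
  have "monomial_subexponent dicke_2_2 = 1"
    unfolding monomial_subexponent_def k
    by (rule inverse_lim_least_ratio_eq_1) (use dicke_power_lower_bound unit_power_from_dicke_power in blast)+
  moreover have "subexponent dicke_2_2 = 1"
    unfolding subexponent_def k
    by (rule inverse_lim_least_ratio_eq_1) (use dicke_power_lower_bound unit_power_from_dicke_power in blast)+
  ultimately show ?thesis by simp
qed

end
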